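(* Let $F$ be a transcendental meromorphic function in $\mathbb{C}_p$ all of whose poles are simple except for a finite number of them. Suppose moreover that, for every $\beta\in\mathbb{C}_p$, all the zeros of the function $F-\beta$ are simple except for a finite number of them. Then $F$ is pseudo-prime.
   Context: $p$ is a prime number and $\mathbb{C}_p$ is the completion of an algebraic closure of the field $\mathbb{Q}_p$ of $p$-adic numbers, with the usual $p$-adic absolute value $|\cdot|$. $\mathcal{A}(\mathbb{C}_p)$ is the algebra of entire functions on $\mathbb{C}_p$ (power series over $\mathbb{C}_p$ converging on all of $\mathbb{C}_p$), and $\mathcal{M}(\mathbb{C}_p)$, the field of meromorphic functions in $\mathbb{C}_p$, is its field of fractions. A meromorphic function is transcendental if it is not a rational function. A function $F\in\mathcal{M}(\mathbb{C}_p)$ is pseudo-prime if every factorization $F=f\circ g$ with $f,g\in\mathcal{M}(\mathbb{C}_p)$ implies that $f$ or $g$ is a rational function. *)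

theory Defs
  imports
    "HOL-Analysis.Analysis"
    "HOL-Computational_Algebra.Computational_Algebra"
    "HOL-Computational_Algebra.Fraction_Field"
begin

definition algebraic_over :: "'a::field set \<Rightarrow> 'a \<Rightarrow> bool" where
  "algebraic_over S x \<longleftrightarrow> (\<exists>q. q \<noteq> 0 \<and> (\<forall>i. coeff q i \<in> S) \<and> poly q x = 0)"

text \<open>
  The type \<open>'a\<close> with the absolute value \<open>absv\<close> is a completion of an algebraic closure of
  the field of \<open>p\<close>-adic numbers. Inside \<open>'a\<close>, the \<open>p\<close>-adic numbers are the topological closure of
  the rationals (\<open>'a\<close> is complete and \<open>absv\<close> restricts to the \<open>p\<close>-adic absolute value), and
  the algebraic closure consists of all elements algebraic over it. Completeness comes from
  the class \<^class>\<open>complete_space\<close>. That \<open>'a\<close> itself is algebraically closed is a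
  consequence and is not assumed.
\<close>
locale padic_complex_field =
  fixes p :: nat and absv :: "'a::{field_char_0, complete_space} \<Rightarrow> real"
  assumes prime_p: "prime p"
    and absv_eq_0_iff: "absv x = 0 \<longleftrightarrow> x = 0"
    and absv_nonneg: "absv x \<ge> 0"
    and absv_mult: "absv (x * y) = absv x * absv y"
    and absv_ultrametric: "absv (x + y) \<le> max (absv x) (absv y)"
    and absv_of_int: "n \<noteq> 0 \<Longrightarrow> absv (of_int n) = 1 / real p ^ multiplicity (int p) n"
    and dist_absv: "dist x y = absv (x - y)"
    and algebraic_closure_closed:
      "degree q > 0 \<Longrightarrow> (\<And>i. algebraic_over (closure \<rat>) (coeff q i)) \<Longrightarrow>
         \<exists>x::'a. algebraic_over (closure \<rat>) x \<and> poly q x = 0"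
    and algebraic_closure_dense: "closure {x::'a. algebraic_over (closure \<rat>) x} = UNIV"

definition entire :: "'a::{field, topological_space} fps \<Rightarrow> bool" where
  "entire h \<longleftrightarrow> (\<forall>x. summable (\<lambda>n. fps_nth h n * x ^ n))"

definition fps_value :: "'a::{field, topological_space} fps \<Rightarrow> 'a \<Rightarrow> 'a" where
  "fps_value h x = (\<Sum>n. fps_nth h n * x ^ n)"

text \<open>
  The field of fractions of the ring of entire functions, as a subfield of the field of
  fractions of the ring of all formal power series.
\<close>
definition meromorphic :: "'a::{field, topological_space} fps fract set" where
  "meromorphic = {Fract h l | h l. entire h \<and> entire l \<and> l \<noteq> 0}"

definition rational_function :: "'a::field fps fract \<Rightarrow> bool" where
  "rational_function F \<longleftrightarrow>
     (\<exists>P Q. Q \<noteq> 0 \<and> F = Fract (fps_of_poly P) (fps_of_poly Q))"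

definition transcendental :: "'a::{field, topological_space} fps fract \<Rightarrow> bool" where
  "transcendental F \<longleftrightarrow> F \<in> meromorphic \<and> \<not> rational_function F"

text \<open>
  \<open>F\<close> is regular at \<open>a\<close> with value \<open>y\<close>. A common zero of a numerator and a denominator can be
  divided out, so \<open>F\<close> has no value at \<open>a\<close> exactly when \<open>a\<close> is a pole.
\<close>
definition has_value :: "'a::{field, topological_space} fps fract \<Rightarrow> 'a \<Rightarrow> 'a \<Rightarrow> bool" where
  "has_value F a y \<longleftrightarrow>
     (\<exists>h l. entire h \<and> entire l \<and> fps_value l a \<noteq> 0 \<and> F = Fract h l \<and>
            y = fps_value h a / fps_value l a)"

definition pole_at :: "'a::{field, topological_space} fps fract \<Rightarrow> 'a \<Rightarrow> bool" where
  "pole_at F a \<longleftrightarrow> (\<nexists>y. has_value F a y)"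

definition zero_at :: "'a::{field, topological_space} fps fract \<Rightarrow> 'a \<Rightarrow> bool" where
  "zero_at F a \<longleftrightarrow> has_value F a 0"

definition has_order :: "'a::{field, topological_space} fps fract \<Rightarrow> 'a \<Rightarrow> int \<Rightarrow> bool" where
  "has_order F a k \<longleftrightarrow>
     (\<exists>h l. entire h \<and> entire l \<and> fps_value h a \<noteq> 0 \<and> fps_value l a \<noteq> 0 \<and>
            F = Fract (fps_X - fps_const a) 1 powi k * Fract h l)"

definition simple_zero_at :: "'a::{field, topological_space} fps fract \<Rightarrow> 'a \<Rightarrow> bool" where
  "simple_zero_at F a \<longleftrightarrow> has_order F a 1"

definition simple_pole_at :: "'a::{field, topological_space} fps fract \<Rightarrow> 'a \<Rightarrow> bool" where
  "simple_pole_at F a \<longleftrightarrow> has_order F a (-1)"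

definition const_fun :: "'a::field \<Rightarrow> 'a fps fract" where
  "const_fun b = Fract (fps_const b) 1"

text \<open>
  \<open>F = f \<circ> g\<close>: the values of \<open>F\<close> and \<open>f \<circ> g\<close> in the projective line agree at every
  point that is not a pole of \<open>g\<close>; in particular \<open>F\<close> has a pole at such a point \<open>z\<close> iff \<open>f\<close> has
  one at \<open>g z\<close>. Nothing is required at the poles of \<open>g\<close>, where \<open>f \<circ> g\<close> need not make sense;
  they are isolated, so \<open>F\<close> is determined by \<open>f\<close> and \<open>g\<close>.
\<close>
definition is_composition ::
  "'a::{field, topological_space} fps fract \<Rightarrow> 'a fps fract \<Rightarrow> 'a fps fract \<Rightarrow> bool" where
  "is_composition F f g \<longleftrightarrow>
     (\<forall>z w. has_value g z w \<longrightarrow> (\<forall>v. has_value F z v \<longleftrightarrow> has_value f w v))"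

definition pseudo_prime :: "'a::{field, topological_space} fps fract \<Rightarrow> bool" where
  "pseudo_prime F \<longleftrightarrow> F \<in> meromorphic \<and>
     (\<forall>f\<in>meromorphic. \<forall>g\<in>meromorphic.
        is_composition F f g \<longrightarrow> rational_function f \<or> rational_function g)"

end

theory Submission
  imports Defs
begin

text \<open>
  Let \<open>F = f \<circ> g\<close> with \<open>g\<close> not rational, and call \<open>w\<close> ramified for \<open>f\<close> if \<open>f\<close> is not locally
  injective at \<open>w\<close>, that is, if the Wronskian \<open>W = h' l - h l'\<close> of a representation \<open>f = h / l\<close>
  reduced at \<open>w\<close> vanishes there. Every \<open>z\<close> with \<open>g z = w\<close> is then a multiple pole of \<open>F\<close> or a
  multiple zero of \<open>F - \<beta>\<close> for one fixed \<open>\<beta>\<close>, so the fibre of \<open>g\<close> over \<open>w\<close> is finite. As \<open>g\<close> is not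
  rational, at most one of its fibres is finite: \<open>f\<close> is unramified outside a single point \<open>w\<close>.

  If \<open>h\<close> and \<open>l\<close> had no common zeros, then \<open>W = c T\<^sup>k\<close> with \<open>T = X - w\<close>, and
  \<open>T W' = k W\<close> would show that \<open>l\<close> divides \<open>T l'' - k l'\<close>, whose Gauss norm on a large disc of
  radius \<open>r\<close> is at most \<open>1 / r\<close> times that of \<open>l\<close>; hence \<open>T l'' = k l'\<close>, so \<open>l\<close>, and likewise \<open>h\<close>,
  is a polynomial. Greatest common divisors are avoided by working with the entire functions
  \<open>\<alpha> = T\<^sup>k l\<^sup>2 / W\<close>, \<open>\<beta> = T\<^sup>k h l / W\<close>, \<open>\<gamma> = T\<^sup>k h\<^sup>2 / W\<close> (the squares and the product of the
  reduced numerator and denominator), for which \<open>f = \<beta> / \<alpha>\<close>.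
\<close>

text \<open>The obstacle is to pass from orders of zeros at single points to global statements.
  Where h and l share the factor (X - a)^n and nothing more, with a different from w, the order of W
  is exactly 2n, because the reduced pair is unramified there. So W divides T^k x y at every point
  for x, y among h, l. To obtain an entire quotient, the zeros in a disc are split off one at a
  time; what remains of the divisor is zero-free in the disc and a unit there, and the quotients for
  different discs coincide as formal series. That a zero-free function is a unit rests on the
  dominance of its constant term, hence on splitting polynomials into linear factors. The field is
  given only as a completion of an algebraic closure, and its discs are not compact, so roots are
  produced as limits of approximate roots. The same tools settle the fibres: if those over w1 and w2
  are finite, (g - w2) / (g - w1) has finitely many zeros and poles, so it is rational, and g with
  it.\<close>

subsection \<open>Algebra of the Wronskian relations\<close>

text \<open>The model case is \<open>a = y\<^sup>2\<close>, \<open>b = x y\<close>, \<open>c = x\<^sup>2\<close> for functions \<open>x\<close>, \<open>y\<close> with Wronskian \<open>V\<close>;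
  suffixes 1 and 2 stand for derivatives. Both sides are then
  \<open>4 y\<^sup>3 (T y'' - k y') T V\<^sup>2\<close>.\<close>
lemma wronskian_identity:
  fixes a b c a1 b1 c1 a2 b2 c2 V V1 T k :: "'b :: idom"
  assumes ac: "a * c = b\<^sup>2" "a1 * c + a * c1 = 2 * b * b1" "a2 * c + 2 * a1 * c1 + a * c2 = 2 * b1\<^sup>2 + 2 * b * b2"
    and ab: "a * b1 - b * a1 = V * a" "a * b2 - b * a2 = V1 * a + V * a1"
    and V: "T * V1 = k * V" and a: "a \<noteq> 0"
  shows "(2 * T * a * a2 - T * a1\<^sup>2 - 2 * k * a * a1) * (T * V\<^sup>2)
    = a\<^sup>2 * ((T * a2 - k * a1) * (T * c2 - k * c1) - (T * b2 - k * b1)\<^sup>2)"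
proof -
  define A where "A = T * a2 - k * a1"
  define B where "B = T * b2 - k * b1"
  define C where "C = T * c2 - k * c1"
  have b1: "a * b1 = b * a1 + V * a" and b2: "a * b2 = b * a2 + V1 * a + V * a1"
    using ab by (simp_all add: algebra_simps)
  have "a * B = T * (a * b2) - k * (a * b1)" by (simp add: B_def algebra_simps)
  also have "\<dots> = b * A + T * V * a1 + (T * V1) * a - k * V * a"
    unfolding b1 b2 by (simp add: A_def algebra_simps)
  finally have B: "a * B = b * A + T * V * a1" unfolding V by simp
  have c1: "a * c1 = 2 * b * b1 - a1 * c" and c2: "a * c2 = 2 * b1\<^sup>2 + 2 * b * b2 - a2 * c - 2 * a1 * c1"
    using ac(2,3) by (simp_all add: algebra_simps)
  have "a\<^sup>2 * c1 = 2 * b * (a * b1) - a1 * (a * c)"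
    using arg_cong[OF c1, of "\<lambda>x. a * x"] by (simp add: algebra_simps power2_eq_square)
  hence c1': "a\<^sup>2 * c1 = b\<^sup>2 * a1 + 2 * V * a * b"
    unfolding b1 ac(1) by (simp add: algebra_simps power2_eq_square)
  have "a * C = T * (a * c2) - k * (a * c1)" by (simp add: C_def algebra_simps)
  also have "\<dots> = 2 * T * b1\<^sup>2 + 2 * b * B - c * A - 2 * T * a1 * c1"
    unfolding c1 c2 by (simp add: A_def B_def algebra_simps)
  finally have "a\<^sup>2 * (a * C) = a\<^sup>2 * (2 * T * b1\<^sup>2 + 2 * b * B - c * A - 2 * T * a1 * c1)" by simp
  also have "\<dots> = 2 * T * (a * b1)\<^sup>2 + 2 * a * b * (a * B) - a * (a * c) * A - 2 * T * a1 * (a\<^sup>2 * c1)"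
    by (simp add: algebra_simps power2_eq_square)
  also have "\<dots> = a * (2 * T * V\<^sup>2 * a + b\<^sup>2 * A + 2 * b * T * V * a1)"
    unfolding b1 B ac(1) c1' by (simp add: algebra_simps power2_eq_square)
  finally have "a * (a\<^sup>2 * C) = a * (2 * T * V\<^sup>2 * a + b\<^sup>2 * A + 2 * b * T * V * a1)"
    by (simp add: mult_ac)
  hence C: "a\<^sup>2 * C = 2 * T * V\<^sup>2 * a + b\<^sup>2 * A + 2 * b * T * V * a1" using a by simp
  have "a\<^sup>2 * (A * C - B\<^sup>2) = A * (a\<^sup>2 * C) - (a * B)\<^sup>2" by (simp add: algebra_simps power2_eq_square)
  also have "\<dots> = 2 * T * V\<^sup>2 * a * A - (T * V * a1)\<^sup>2"
    unfolding C B by (simp add: algebra_simps power2_eq_square)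
  also have "\<dots> = (2 * T * a * a2 - T * a1\<^sup>2 - 2 * k * a * a1) * (T * V\<^sup>2)"
    by (simp add: A_def algebra_simps power2_eq_square)
  finally show ?thesis by (simp add: A_def B_def C_def)
qed

text \<open>For \<open>\<alpha> = y\<^sup>2\<close> this is \<open>4 y\<^sup>3 (T y'' - k y')\<close>.\<close>
definition sqrt_ode :: "nat \<Rightarrow> 'a :: field_char_0 fps \<Rightarrow> 'a fps \<Rightarrow> 'a fps" where
  "sqrt_ode k T \<alpha> = 2 * T * \<alpha> * fps_deriv (fps_deriv \<alpha>) - T * (fps_deriv \<alpha>)\<^sup>2
     - 2 * of_nat k * \<alpha> * fps_deriv \<alpha>"

text \<open>The equation \<open>euler_part k T u = 0\<close> is the one expected of a coprime
  numerator and denominator. For T' = 1 its solutions are spanned by 1 and T^(k+1).\<close>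

definition euler_part :: "nat \<Rightarrow> 'a :: field_char_0 fps \<Rightarrow> 'a fps \<Rightarrow> 'a fps" where
  "euler_part k T \<alpha> = T * fps_deriv (fps_deriv \<alpha>) - of_nat k * fps_deriv \<alpha>"

text \<open>In the model case, T V' = k V says y L(x) = x L(y) for L(u) = T u'' - k u', so L(x) =
  \<lambda> x and L(y) = \<lambda> y with a common \<lambda>. The determinant of the three Euler
  parts is then 4 \<lambda> T V^2, and both sides are 4 \<lambda> y^4 T V^2. The right-hand side
  exposes the factor \<open>\<alpha>\<^sup>2\<close>, which takes over the part of the divisor
  l.\<close>

lemma sqrt_ode_identity:
  fixes \<alpha> \<beta> \<gamma> V T :: "'a :: field_char_0 fps"
  assumes eq: "\<alpha> * \<gamma> = \<beta>\<^sup>2" "\<alpha> * fps_deriv \<beta> - \<beta> * fps_deriv \<alpha> = V * \<alpha>"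
    and V: "T * fps_deriv V = of_nat k * V" and "\<alpha> \<noteq> 0"
  shows "sqrt_ode k T \<alpha> * (T * V\<^sup>2) = \<alpha>\<^sup>2 * (euler_part k T \<alpha> * euler_part k T \<gamma> - (euler_part k T \<beta>)\<^sup>2)"
  unfolding sqrt_ode_def euler_part_def
proof (rule wronskian_identity[where ?V1.0 = "fps_deriv V", OF eq(1) _ _ eq(2) _ V \<open>\<alpha> \<noteq> 0\<close>])
  show 1: "fps_deriv \<alpha> * \<gamma> + \<alpha> * fps_deriv \<gamma> = 2 * \<beta> * fps_deriv \<beta>"
    using arg_cong[OF eq(1), of fps_deriv] by (simp add: power2_eq_square algebra_simps)
  show "fps_deriv (fps_deriv \<alpha>) * \<gamma> + 2 * fps_deriv \<alpha> * fps_deriv \<gamma> + \<alpha> * fps_deriv (fps_deriv \<gamma>)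
      = 2 * (fps_deriv \<beta>)\<^sup>2 + 2 * \<beta> * fps_deriv (fps_deriv \<beta>)"
    using arg_cong[OF 1, of fps_deriv] by (simp add: power2_eq_square algebra_simps)
  show "\<alpha> * fps_deriv (fps_deriv \<beta>) - \<beta> * fps_deriv (fps_deriv \<alpha>) = fps_deriv V * \<alpha> + V * fps_deriv \<alpha>"
    using arg_cong[OF eq(2), of fps_deriv] by (simp add: algebra_simps)
qed

lemma mult_deriv_power:
  fixes T :: "'a :: field_char_0 fps"
  assumes "fps_deriv T = 1" shows "T * fps_deriv (T ^ k) = of_nat k * T ^ k"
  using assms by (induction k) (simp_all add: algebra_simps)

lemma funpow_deriv_0_imp_poly:
  fixes h :: "'a :: field_char_0 fps"
  assumes "(fps_deriv ^^ N) h = 0" shows "\<exists>M. \<forall>n\<ge>M. fps_nth h n = 0"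
  using assms
proof (induction N arbitrary: h)
  case (Suc N)
  hence "(fps_deriv ^^ N) (fps_deriv h) = 0" by (simp add: funpow_swap1)
  then obtain M where M: "\<And>n. n \<ge> M \<Longrightarrow> fps_nth (fps_deriv h) n = 0" using Suc.IH by blast
  have "fps_nth h n = 0" if n: "n \<ge> Suc M" for n
  proof -
    obtain m where m: "n = Suc m" "m \<ge> M" using n by (cases n) auto
    have "(1 + of_nat m) * fps_nth h (Suc m) = 0" using M[OF m(2)] by simp
    moreover have "(1 + of_nat m :: 'a) \<noteq> 0" by (metis of_nat_Suc of_nat_neq_0)
    ultimately show ?thesis using m by simp
  qed
  thus ?case by blast
qed auto

text \<open>The \<open>k\<close>-th derivative of the equation has no term of order zero, since the exponents of the
  Euler operator are \<open>k\<close> and \<open>2 k + 1\<close>; the same happens once more in the resulting equation of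
  first order.\<close>
lemma euler_ode_imp_poly:
  fixes u T :: "'a :: field_char_0 fps"
  assumes T: "fps_deriv T = 1" "T \<noteq> 0"
    and ode: "T\<^sup>2 * fps_deriv (fps_deriv u) - 3 * of_nat k * T * fps_deriv u + of_nat (k * (2 * k + 1)) * u = 0"
  shows "(fps_deriv ^^ (2 * k + 2)) u = 0"
proof -
  define D where "D = (\<lambda>n. (fps_deriv ^^ n) u)"
  have D: "fps_deriv (D n) = D (Suc n)" for n by (simp add: D_def)
  have step1: "T\<^sup>2 * D (n + 2) + of_int (2 * int n - 3 * int k) * T * D (n + 1)
      + of_int (int n * (int n - 1) - 3 * int k * int n + int k * (2 * int k + 1)) * D n = 0" for n
  proof (induction n)
    case 0
    show ?case using ode by (simp add: D_def algebra_simps numeral_2_eq_2)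
  next
    case (Suc n)
    show ?case using arg_cong[OF Suc, of fps_deriv] T(1)
      by (simp add: D power2_eq_square algebra_simps)
  qed
  have "T * (T * D (k + 2) - of_nat k * D (k + 1)) = 0"
    using step1[of k] by (simp add: power2_eq_square algebra_simps)
  hence "T * D (k + 2) = of_nat k * D (k + 1)" using T(2) by simp
  hence step2: "T * D (k + 2 + j) = of_int (int k - int j) * D (k + 1 + j)" for j
  proof (induction j)
    case (Suc j)
    have "T * D (k + 2 + j) = of_int (int k - int j) * D (k + 1 + j)" by (rule Suc.IH[OF Suc.prems])
    from arg_cong[OF this, of fps_deriv] T(1) show ?case
      by (simp add: D algebra_simps)
  qed simp
  have "T * D (k + 2 + k) = 0" using step2[of k] by simp
  hence "D (k + 2 + k) = 0" using T(2) by simp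
  thus ?thesis by (simp add: D_def mult_2 add_ac)
qed

text \<open>The equation is quadratic in \<alpha>. Multiplying its derivative by T and eliminating T
  (\<alpha>')^2 by means of the equation itself makes 2 \<alpha> a common factor; what is left is a
  linear equation for \<alpha>' of Euler type.\<close>

lemma sqrt_ode_imp_poly:
  fixes \<alpha> T :: "'a :: field_char_0 fps"
  assumes T: "fps_deriv T = 1" "T \<noteq> 0" and \<alpha>: "\<alpha> \<noteq> 0" and ode: "sqrt_ode k T \<alpha> = 0"
  shows "\<exists>M. \<forall>n\<ge>M. fps_nth \<alpha> n = 0"
proof -
  define a1 a2 a3 where "a1 = fps_deriv \<alpha>" and "a2 = fps_deriv a1" and "a3 = fps_deriv a2"
  have e: "2 * T * \<alpha> * a2 - T * a1\<^sup>2 - 2 * of_nat k * \<alpha> * a1 = 0"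
    using ode by (simp add: sqrt_ode_def a1_def a2_def)
  have "fps_deriv (2 * T * \<alpha> * a2 - T * a1\<^sup>2 - 2 * of_nat k * \<alpha> * a1)
      = 2 * T * \<alpha> * a3 + 2 * \<alpha> * a2 - a1\<^sup>2 - 2 * of_nat k * a1\<^sup>2 - 2 * of_nat k * \<alpha> * a2"
    using T(1) by (simp add: a1_def[symmetric] a2_def[symmetric] a3_def[symmetric] power2_eq_square algebra_simps)
  hence "2 * T * \<alpha> * a3 + 2 * \<alpha> * a2 - a1\<^sup>2 - 2 * of_nat k * a1\<^sup>2 - 2 * of_nat k * \<alpha> * a2 = 0"
    by (simp add: e)
  hence "T * (2 * T * \<alpha> * a3 + 2 * \<alpha> * a2 - a1\<^sup>2 - 2 * of_nat k * a1\<^sup>2 - 2 * of_nat k * \<alpha> * a2)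
      + (1 + 2 * of_nat k) * (T * a1\<^sup>2 - (2 * T * \<alpha> * a2 - 2 * of_nat k * \<alpha> * a1)) = 0"
    using e by (simp add: algebra_simps)
  hence "(2 * \<alpha>) * (T\<^sup>2 * a3 - 3 * of_nat k * T * a2 + of_nat (k * (2 * k + 1)) * a1) = 0"
    by (simp add: power2_eq_square algebra_simps)
  hence "T\<^sup>2 * a3 - 3 * of_nat k * T * a2 + of_nat (k * (2 * k + 1)) * a1 = 0"
    using \<alpha> by simp
  hence "(fps_deriv ^^ (2 * k + 2)) a1 = 0"
    using T unfolding a2_def a3_def by (intro euler_ode_imp_poly)
  hence "(fps_deriv ^^ Suc (2 * k + 2)) \<alpha> = 0" 
    by (simp only: funpow_Suc_right comp_apply a1_def)
  thus ?thesis by (rule funpow_deriv_0_imp_poly)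
qed

context padic_complex_field
begin

subsection \<open>Entire functions and their values\<close>

lemma absv_0 [simp]: "absv 0 = 0"
  by (simp add: absv_eq_0_iff)

lemma absv_pos_iff [simp]: "absv x > 0 \<longleftrightarrow> x \<noteq> 0"
  using absv_nonneg[of x] absv_eq_0_iff[of x] by linarith

lemma absv_1 [simp]: "absv 1 = 1"
  using absv_of_int[of 1] by simp

lemma absv_power [simp]: "absv (x ^ n) = absv x ^ n"
  by (induction n) (simp_all add: absv_mult)

lemma absv_minus [simp]: "absv (- x) = absv x"
proof -
  have "absv (-1) * absv (-1) = 1"
    by (simp flip: absv_mult)
  hence "absv (-1) = 1"
    using absv_nonneg[of "-1"] square_eq_1_iff[of "absv (-1)"] by linarith
  thus ?thesis using absv_mult[of "-1" x] by simp
qed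

lemma absv_minus_commute: "absv (x - y) = absv (y - x)"
  using absv_minus[of "x - y"] by simp

lemma absv_add_le: "absv x \<le> C \<Longrightarrow> absv y \<le> C \<Longrightarrow> absv (x + y) \<le> C"
  using absv_ultrametric[of x y] by linarith

lemma absv_diff_le: "absv x \<le> C \<Longrightarrow> absv y \<le> C \<Longrightarrow> absv (x - y) \<le> C"
  using absv_add_le[of x C "- y"] by simp

lemma absv_add_eq: 
  assumes "absv y < absv x" shows "absv (x + y) = absv x"
proof -
  have "absv (x + y) \<le> absv x" using assms by (intro absv_add_le) auto
  moreover have "absv x \<le> max (absv (x + y)) (absv (- y))"
    using absv_ultrametric[of "x + y" "- y"] by simp
  ultimately show ?thesis using assms by auto
qed

lemma absv_sum_le:
  assumes "\<And>i. i \<in> I \<Longrightarrow> absv (f i) \<le> C" "0 \<le> C"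
  shows "absv (sum f I) \<le> C"
  using assms by (induction I rule: infinite_finite_induct) (auto intro: absv_add_le)

lemma absv_of_nat_le: "absv (of_nat n) \<le> 1"
  by (induction n) (auto intro: absv_add_le)

lemma absv_inverse: "absv (inverse x) = inverse (absv x)"
proof (cases "x = 0")
  case False
  hence "absv x * absv (inverse x) = 1" using absv_mult[of x "inverse x"] by simp
  thus ?thesis using inverse_unique by metis
qed auto

lemma absv_divide: "absv (x / y) = absv x / absv y"
  by (simp add: divide_inverse absv_mult absv_inverse)

lemma absv_p: "absv (of_nat p) = 1 / real p"
proof -
  have "multiplicity (int p) (int p) = 1"
    using prime_p by (intro multiplicity_self) auto
  thus ?thesis using absv_of_int[of "int p"] prime_p by (auto simp: prime_gt_0_nat)
qed

lemma ex_absv_small: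
  assumes "\<delta> > 0" shows "\<exists>x. x \<noteq> 0 \<and> absv x < \<delta>"
proof -
  have p1: "real p > 1" using prime_p prime_gt_1_nat by force
  then obtain n where "(1 / real p) ^ n < \<delta>"
    using real_arch_pow_inv[of \<delta> "1 / real p"] assms by auto
  moreover have "(of_nat p :: 'a) \<noteq> 0" using p1 by auto
  ultimately show ?thesis by (intro exI[of _ "of_nat p ^ n"]) (simp add: absv_p)
qed

lemma ex_absv_large: "\<exists>x. R \<le> absv x"
proof -
  obtain x where x: "x \<noteq> 0" "absv x < 1 / (\<bar>R\<bar> + 1)" using ex_absv_small[of "1 / (\<bar>R\<bar> + 1)"] by (auto simp: add_nonneg_pos)
  have "absv x * \<bar>R\<bar> \<le> absv x * (\<bar>R\<bar> + 1)" by (intro mult_left_mono absv_nonneg) auto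
  also have "\<dots> < 1" using x by (simp add: field_simps)
  finally have "\<bar>R\<bar> \<le> inverse (absv x)" using x by (simp add: field_simps)
  thus ?thesis by (intro exI[of _ "inverse x"]) (simp add: absv_inverse)
qed

lemma tendsto_iff_absv: "(X \<longlongrightarrow> L) F \<longleftrightarrow> ((\<lambda>n. absv (X n - L)) \<longlongrightarrow> 0) F"
  by (subst tendsto_dist_iff) (simp add: dist_absv)

lemma absv_lim_le:
  assumes "X \<longlonglongrightarrow> L" "\<And>n. absv (X n) \<le> C"
  shows "absv L \<le> C"
proof (rule ccontr)
  assume "\<not> absv L \<le> C"
  moreover have "absv (X 0) \<ge> 0" by (rule absv_nonneg)
  ultimately have L: "absv L > C" "absv L > 0" using assms(2)[of 0] by linarith+
  have "eventually (\<lambda>n. absv (X n - L) < absv L) sequentially"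
    using assms(1) L(2) unfolding tendsto_iff_absv by (rule order_tendstoD)
  then obtain n where "absv (X n - L) < absv L" by (auto simp: eventually_sequentially)
  hence "absv (L + (X n - L)) = absv L" by (rule absv_add_eq)
  with assms(2)[of n] L show False by simp
qed

lemma tendsto_0_le:
  fixes f g :: "nat \<Rightarrow> real"
  assumes "g \<longlonglongrightarrow> 0" "\<And>n. 0 \<le> f n" "\<And>n. f n \<le> g n"
  shows "f \<longlonglongrightarrow> 0"
  using assms by (intro tendsto_sandwich[OF _ _ tendsto_const assms(1)]) simp_all

text \<open>By the ultrametric inequality a block of terms is no larger than its largest term, so
  null sequences already have Cauchy partial sums.\<close>

lemma summable_iff_absv: "summable a \<longleftrightarrow> (\<lambda>n. absv (a n)) \<longlonglongrightarrow> 0"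
proof
  assume "summable a"
  then obtain s where s: "(\<lambda>n. \<Sum>i<n. a i) \<longlonglongrightarrow> s" by (auto simp: summable_def sums_def)
  define d where "d = (\<lambda>n. absv ((\<Sum>i<n. a i) - s))"
  have d: "d \<longlonglongrightarrow> 0" using s unfolding tendsto_iff_absv d_def .
  have "(\<lambda>n. d (Suc n) + d n) \<longlonglongrightarrow> 0 + 0"
    using d by (intro tendsto_add LIMSEQ_Suc)
  hence "(\<lambda>n. d (Suc n) + d n) \<longlonglongrightarrow> 0" by simp
  moreover have "absv (a n) \<le> d (Suc n) + d n" for n
  proof -
    have "a n = ((\<Sum>i<Suc n. a i) - s) - ((\<Sum>i<n. a i) - s)"
      unfolding sum.lessThan_Suc by (simp only: diff_diff_eq2 diff_add_cancel add_diff_cancel_left')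
    moreover have "absv (x - y) \<le> absv x + absv y" for x y
      using absv_nonneg[of x] absv_nonneg[of y] by (intro absv_diff_le) auto
    ultimately show ?thesis unfolding d_def by (subst (1) \<open>a n = _\<close>)
  qed
  ultimately show "(\<lambda>n. absv (a n)) \<longlonglongrightarrow> 0"
    by (rule tendsto_0_le[OF _ absv_nonneg])
next
  assume a: "(\<lambda>n. absv (a n)) \<longlonglongrightarrow> 0"
  have "Cauchy (\<lambda>n. \<Sum>i<n. a i)"
  proof (rule metric_CauchyI)
    fix e :: real assume "e > 0"
    with a have "eventually (\<lambda>n. absv (a n) < e / 2) sequentially"
      by (intro order_tendstoD(2)) auto
    then obtain N where N: "\<And>n. n \<ge> N \<Longrightarrow> absv (a n) < e / 2" by (auto simp: eventually_sequentially)
    have *: "absv ((\<Sum>i<n. a i) - (\<Sum>i<m. a i)) < e" if "N \<le> m" "m \<le> n" for m n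
    proof -
      have "(\<Sum>i<n. a i) - (\<Sum>i<m. a i) = sum a {m..<n}"
        using that by (simp add: lessThan_atLeast0 sum_diff_nat_ivl)
      also have "absv \<dots> \<le> e / 2"
        using that N \<open>e > 0\<close> by (intro absv_sum_le) (auto intro!: less_imp_le)
      finally show ?thesis using \<open>e > 0\<close> by simp
    qed
    show "\<exists>M. \<forall>m\<ge>M. \<forall>n\<ge>M. dist (\<Sum>i<m. a i) (\<Sum>i<n. a i) < e"
    proof (intro exI allI impI)
      fix m n assume "N \<le> m" "N \<le> n"
      thus "dist (\<Sum>i<m. a i) (\<Sum>i<n. a i) < e"
        using *[of m n] *[of n m] by (cases "m \<le> n") (auto simp: dist_absv absv_minus_commute)
    qed
  qed
  hence "convergent (\<lambda>n. \<Sum>i<n. a i)" by (rule Cauchy_convergent)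
  thus "summable a" by (simp add: summable_iff_convergent)
qed

lemma entire_iff: "entire (h :: 'a fps) \<longleftrightarrow> (\<forall>r>0. \<exists>C. \<forall>n. absv (fps_nth h n) * r ^ n \<le> C)"
proof
  assume h: "entire h"
  show "\<forall>r>0. \<exists>C. \<forall>n. absv (fps_nth h n) * r ^ n \<le> C"
  proof (intro allI impI)
    fix r :: real assume "r > 0"
    obtain x where x: "r \<le> absv x" using ex_absv_large by blast
    have "(\<lambda>n. absv (fps_nth h n * x ^ n)) \<longlonglongrightarrow> 0"
      using h by (simp add: entire_def summable_iff_absv)
    hence "Bseq (\<lambda>n. absv (fps_nth h n * x ^ n))" by (rule convergent_imp_Bseq[OF convergentI])
    then obtain C where C: "\<And>n. absv (fps_nth h n * x ^ n) \<le> C"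
      by (auto simp: Bseq_def absv_nonneg)
    have "absv (fps_nth h n) * r ^ n \<le> C" for n
    proof -
      have "absv (fps_nth h n) * r ^ n \<le> absv (fps_nth h n) * absv x ^ n"
        using x \<open>r > 0\<close> by (intro mult_left_mono power_mono absv_nonneg) auto
      also have "\<dots> \<le> C" using C[of n] by (simp add: absv_mult)
      finally show ?thesis .
    qed
    thus "\<exists>C. \<forall>n. absv (fps_nth h n) * r ^ n \<le> C" by blast
  qed
next
  assume *: "\<forall>r>0. \<exists>C. \<forall>n. absv (fps_nth h n) * r ^ n \<le> C"
  show "entire h" unfolding entire_def summable_iff_absv
  proof
    fix x :: 'a
    \<comment> \<open>Any radius beyond |x| gives a geometric majorant with ratio |x| / r < 1; the
      added 1 keeps r positive at x = 0.\<close>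
    define r where "r = 2 * (absv x + 1)"
    have r: "r > 0" "absv x / r < 1" "absv x / r \<ge> 0"
      unfolding r_def using absv_nonneg[of x] by (auto simp: field_simps)
    hence r': "norm (absv x / r) < 1" using absv_nonneg[of x] by simp
    from * r(1) obtain C where C: "\<And>n. absv (fps_nth h n) * r ^ n \<le> C" by blast
    have "(\<lambda>n. C * (absv x / r) ^ n) \<longlonglongrightarrow> C * 0"
      by (intro tendsto_mult tendsto_const LIMSEQ_power_zero r')
    hence "(\<lambda>n. C * (absv x / r) ^ n) \<longlonglongrightarrow> 0" by simp
    moreover have "absv (fps_nth h n * x ^ n) \<le> C * (absv x / r) ^ n" for n
    proof -
      have "absv (fps_nth h n * x ^ n) = (absv (fps_nth h n) * r ^ n) * (absv x / r) ^ n"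
        using r by (simp add: absv_mult field_simps)
      also have "\<dots> \<le> C * (absv x / r) ^ n" using C r by (intro mult_right_mono) auto
      finally show ?thesis .
    qed
    ultimately show "(\<lambda>n. absv (fps_nth h n * x ^ n)) \<longlonglongrightarrow> 0"
      by (rule tendsto_0_le[OF _ absv_nonneg])
  qed
qed

lemma entire_bound:
  assumes "entire (h :: 'a fps)" "r > 0"
  obtains C where "C \<ge> 0" "\<And>n. absv (fps_nth h n) * r ^ n \<le> C"
proof -
  obtain C where C: "\<And>n. absv (fps_nth h n) * r ^ n \<le> C" using assms entire_iff by blast
  have "0 \<le> absv (fps_nth h 0) * r ^ 0" using absv_nonneg by simp
  with C[of 0] have "C \<ge> 0" by linarith
  with C that show ?thesis by blast
qed

lemma entire_tendsto:
  assumes "entire (h :: 'a fps)" "r > 0"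
  shows "(\<lambda>n. absv (fps_nth h n) * r ^ n) \<longlonglongrightarrow> 0"
proof -
  obtain C where C: "C \<ge> 0" "\<And>n. absv (fps_nth h n) * (2 * r) ^ n \<le> C"
    using entire_bound[of h "2 * r"] assms by auto
  have "(\<lambda>n. C * (1 / 2 :: real) ^ n) \<longlonglongrightarrow> C * 0"
    by (intro tendsto_mult tendsto_const LIMSEQ_power_zero) auto
  moreover have "absv (fps_nth h n) * r ^ n \<le> C * (1 / 2) ^ n" for n
    using C(2)[of n] by (simp add: power_mult_distrib field_simps)
  ultimately show ?thesis using assms(2)
    by - (rule tendsto_0_le[where g = "\<lambda>n. C * (1 / 2) ^ n"], simp_all add: absv_nonneg)
qed

lemma entire_add: "entire (h :: 'a fps) \<Longrightarrow> entire (l :: 'a fps) \<Longrightarrow> entire (h + l)"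
  unfolding entire_iff
proof (intro allI impI)
  fix r :: real
  assume h: "\<forall>r>0. \<exists>C. \<forall>n. absv (fps_nth h n) * r ^ n \<le> C"
    and l: "\<forall>r>0. \<exists>C. \<forall>n. absv (fps_nth l n) * r ^ n \<le> C" and r: "r > 0"
  obtain C D where C: "\<And>n. absv (fps_nth h n) * r ^ n \<le> C" and D: "\<And>n. absv (fps_nth l n) * r ^ n \<le> D"
    using h l r by meson
  have "absv (fps_nth (h + l) n) * r ^ n \<le> max C D" for n
  proof -
    have "absv (fps_nth h n) \<le> max C D / r ^ n" "absv (fps_nth l n) \<le> max C D / r ^ n"
      using C[of n] D[of n] r by (simp_all add: pos_le_divide_eq)
    hence "absv (fps_nth h n + fps_nth l n) \<le> max C D / r ^ n" by (rule absv_add_le)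
    thus ?thesis using r by (simp add: pos_le_divide_eq)
  qed
  thus "\<exists>C. \<forall>n. absv (fps_nth (h + l) n) * r ^ n \<le> C" by blast
qed

lemma entire_minus: "entire (h :: 'a fps) \<Longrightarrow> entire (- h)"
  by (simp add: entire_iff)

lemma entire_diff: "entire (h :: 'a fps) \<Longrightarrow> entire (l :: 'a fps) \<Longrightarrow> entire (h - l)"
  using entire_add[of h "- l"] entire_minus[of l] by simp

lemma mult_coeff_bound:
  assumes "\<And>n. absv (fps_nth h n) * r ^ n \<le> C" "\<And>n. absv (fps_nth l n) * r ^ n \<le> D" "r > 0"
  shows "absv (fps_nth (h * l) n) * r ^ n \<le> C * D"
proof -
  have "0 \<le> absv (fps_nth h 0) * r ^ 0" "0 \<le> absv (fps_nth l 0) * r ^ 0" using absv_nonneg by auto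
  hence CD: "C \<ge> 0" "D \<ge> 0" using assms(1)[of 0] assms(2)[of 0] by linarith+
  have "absv (fps_nth (h * l) n) \<le> C * D / r ^ n"
    unfolding fps_mult_nth
  proof (rule absv_sum_le)
    fix i assume i: "i \<in> {0..n}"
    have "absv (fps_nth h i * fps_nth l (n - i)) * r ^ n
        = (absv (fps_nth h i) * r ^ i) * (absv (fps_nth l (n - i)) * r ^ (n - i))"
      using i by (simp add: absv_mult mult_ac flip: power_add)
    also have "\<dots> \<le> C * D" using assms CD absv_nonneg by (intro mult_mono) auto
    finally show "absv (fps_nth h i * fps_nth l (n - i)) \<le> C * D / r ^ n"
      using assms(3) by (simp add: field_simps)
  qed (use CD assms(3) in auto)
  thus ?thesis using assms(3) by (simp add: field_simps)
qed

lemma entire_mult: "entire (h :: 'a fps) \<Longrightarrow> entire (l :: 'a fps) \<Longrightarrow> entire (h * l)"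
  unfolding entire_iff
proof (intro allI impI)
  fix r :: real
  assume h: "\<forall>r>0. \<exists>C. \<forall>n. absv (fps_nth h n) * r ^ n \<le> C"
    and l: "\<forall>r>0. \<exists>C. \<forall>n. absv (fps_nth l n) * r ^ n \<le> C" and r: "r > 0"
  obtain C D where C: "\<And>n. absv (fps_nth h n) * r ^ n \<le> C" and D: "\<And>n. absv (fps_nth l n) * r ^ n \<le> D"
    using h l r by meson
  show "\<exists>C. \<forall>n. absv (fps_nth (h * l) n) * r ^ n \<le> C"
    using mult_coeff_bound[OF C D r] by blast
qed

lemma entire_of_poly [simp]: "entire (fps_of_poly (P :: 'a poly))"
proof -
  have "summable (\<lambda>n. coeff P n * x ^ n)" for x
    by (rule summable_finite[of "{..degree P}"]) (auto simp: coeff_eq_0)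
  thus ?thesis by (simp add: entire_def)
qed

lemma entire_const [simp]: "entire (fps_const (c :: 'a))"
  using entire_of_poly[of "[:c:]"] by (simp add: fps_of_poly_const)

lemma entire_0 [simp]: "entire (0 :: 'a fps)" and entire_1 [simp]: "entire (1 :: 'a fps)"
  using entire_const[of 0] entire_const[of 1] by simp_all

lemma entire_of_nat [simp]: "entire (of_nat n :: 'a fps)"
  using entire_const[of "of_nat n"] by (simp add: fps_of_nat)

lemma entire_numeral [simp]: "entire (numeral n :: 'a fps)"
  using entire_of_nat[of "numeral n"] by simp

lemma entire_X [simp]: "entire (fps_X :: 'a fps)"
  using entire_of_poly[of "[:0, 1:]"] by (simp add: fps_of_poly_pCons)

lemma entire_linear [simp]: "entire (fps_X - fps_const (a :: 'a))"
  by (rule entire_diff[OF entire_X entire_const])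

lemma entire_power: "entire (h :: 'a fps) \<Longrightarrow> entire (h ^ n)"
  by (induction n) (auto intro: entire_mult)

lemma deriv_coeff_bound:
  assumes "\<And>n. absv (fps_nth h n) * r ^ n \<le> C" "r > 0"
  shows "absv (fps_nth (fps_deriv h) n) * r ^ n \<le> C / r"
proof -
  have "absv (fps_nth (fps_deriv h) n) = absv (of_nat (Suc n)) * absv (fps_nth h (Suc n))"
    by (simp add: absv_mult)
  also have "\<dots> \<le> 1 * absv (fps_nth h (Suc n))"
    by (intro mult_right_mono absv_of_nat_le absv_nonneg)
  finally have "absv (fps_nth (fps_deriv h) n) * r ^ n \<le> absv (fps_nth h (Suc n)) * r ^ n"
    using assms by (intro mult_right_mono) auto
  also have "\<dots> \<le> C / r" using assms(1)[of "Suc n"] assms(2) by (simp add: field_simps)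
  finally show ?thesis .
qed

lemma entire_deriv: "entire (h :: 'a fps) \<Longrightarrow> entire (fps_deriv h)"
  unfolding entire_iff using deriv_coeff_bound by meson

lemmas entire_intros = entire_add entire_minus entire_diff entire_mult entire_power entire_deriv

section \<open>Values and division by linear factors\<close>

lemma value_eqI:
  assumes "entire (q :: 'a fps)" "h = (fps_X - fps_const a) * q + fps_const c"
  shows "fps_value h a = c"
proof -
  have h0: "fps_nth h 0 = c - a * fps_nth q 0"
    and hS: "fps_nth h (Suc n) = fps_nth q n - a * fps_nth q (Suc n)" for n
    by (simp_all add: assms(2) left_diff_distrib)
  \<comment> \<open>The partial sums telescope to c minus a term of the convergent series of q.
    Values of sums and products are thereby computed modulo X - a, without Cauchy products of
    series.\<close>
  have *: "(\<Sum>i<Suc n. fps_nth h i * a ^ i) = c - fps_nth q n * a ^ Suc n" for n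
    by (induction n) (simp_all add: h0 hS algebra_simps)
  have "(\<lambda>n. absv (fps_nth q n * a ^ Suc n)) \<longlonglongrightarrow> 0"
  proof -
    have "(\<lambda>n. absv (fps_nth q n * a ^ n)) \<longlonglongrightarrow> 0"
      using assms(1) by (simp add: entire_def summable_iff_absv)
    hence "(\<lambda>n. absv a * absv (fps_nth q n * a ^ n)) \<longlonglongrightarrow> absv a * 0"
      by (intro tendsto_mult tendsto_const)
    thus ?thesis by (simp add: absv_mult mult_ac)
  qed
  hence "(\<lambda>n. \<Sum>i<Suc n. fps_nth h i * a ^ i) \<longlonglongrightarrow> c"
    unfolding tendsto_iff_absv * by simp
  hence "(\<lambda>n. \<Sum>i<n. fps_nth h i * a ^ i) \<longlonglongrightarrow> c" by (rule LIMSEQ_imp_Suc)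
  hence "(\<lambda>n. fps_nth h n * a ^ n) sums c" by (simp add: sums_def)
  thus ?thesis unfolding fps_value_def by (rule sums_unique[symmetric])
qed

text \<open>This is (h - h(a)) / (X - a): the sum collects the X^n terms of the quotients (X^m -
  a^m) / (X - a).\<close>

definition fps_div_linear :: "'a \<Rightarrow> 'a fps \<Rightarrow> 'a fps" where
  "fps_div_linear a h = Abs_fps (\<lambda>n. \<Sum>k. fps_nth h (Suc n + k) * a ^ k)"

lemma div_linear_summable:
  assumes "entire (h :: 'a fps)" shows "summable (\<lambda>k. fps_nth h (n + k) * a ^ k)"
proof -
  have "(\<lambda>k. absv (fps_nth h (n + k)) * (absv a + 1) ^ (n + k)) \<longlonglongrightarrow> 0"
    using LIMSEQ_ignore_initial_segment[OF entire_tendsto[OF assms, of "absv a + 1"], of n]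
      absv_nonneg[of a] by (simp add: add_ac)
  moreover have "absv (fps_nth h (n + k) * a ^ k) \<le> absv (fps_nth h (n + k)) * (absv a + 1) ^ (n + k)" for k
  proof -
    have "absv a ^ k \<le> (absv a + 1) ^ k" using absv_nonneg by (intro power_mono) auto
    also have "\<dots> \<le> (absv a + 1) ^ (n + k)" using absv_nonneg by (intro power_increasing) auto
    finally show ?thesis by (simp add: absv_mult mult_left_mono absv_nonneg)
  qed
  ultimately show ?thesis unfolding summable_iff_absv
    by (rule tendsto_0_le[OF _ absv_nonneg])
qed

text \<open>One step of Horner's rule. The left-hand side is coefficient n - 1 of the quotient if n
  > 0 and the value of h at \<open>a\<close> if n = 0.\<close>

lemma div_linear_step:
  assumes "entire (h :: 'a fps)"
  shows "(\<Sum>k. fps_nth h (n + k) * a ^ k) = fps_nth h n + a * fps_nth (fps_div_linear a h) n"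
proof -
  define u where "u = (\<lambda>k. fps_nth h (n + k) * a ^ k)"
  define s where "s = (\<Sum>k. fps_nth h (Suc n + k) * a ^ k)"
  have "(\<lambda>k. fps_nth h (Suc n + k) * a ^ k) sums s"
    unfolding s_def using div_linear_summable[OF assms] by (rule summable_sums)
  hence 1: "(\<lambda>m. \<Sum>k<m. fps_nth h (Suc n + k) * a ^ k) \<longlonglongrightarrow> s" by (simp add: sums_def)
  have 2: "(\<Sum>k<Suc m. u k) = fps_nth h n + a * (\<Sum>k<m. fps_nth h (Suc n + k) * a ^ k)" for m
    by (induction m) (simp_all add: u_def algebra_simps)
  have "(\<lambda>m. absv a * absv ((\<Sum>k<m. fps_nth h (Suc n + k) * a ^ k) - s)) \<longlonglongrightarrow> absv a * 0"
    using 1 unfolding tendsto_iff_absv by (intro tendsto_mult tendsto_const)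
  hence "(\<lambda>m. \<Sum>k<Suc m. u k) \<longlonglongrightarrow> fps_nth h n + a * s"
    unfolding tendsto_iff_absv 2 by (simp flip: absv_mult add: algebra_simps)
  hence "u sums (fps_nth h n + a * s)"
    unfolding sums_def by (rule LIMSEQ_imp_Suc)
  hence "suminf u = fps_nth h n + a * s" by (rule sums_unique[symmetric])
  thus ?thesis by (simp add: u_def s_def fps_div_linear_def)
qed

lemma div_linear_eq:
  assumes "entire (h :: 'a fps)"
  shows "h = (fps_X - fps_const a) * fps_div_linear a h + fps_const (fps_value h a)"
proof (rule fps_ext)
  fix n
  show "fps_nth h n = fps_nth ((fps_X - fps_const a) * fps_div_linear a h + fps_const (fps_value h a)) n"
  proof (cases n)
    case 0
    have "fps_value h a = fps_nth h 0 + a * fps_nth (fps_div_linear a h) 0"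
      using div_linear_step[OF assms, of 0 a] by (simp add: fps_value_def)
    thus ?thesis using 0 by (simp add: algebra_simps)
  next
    case (Suc m)
    have "fps_nth (fps_div_linear a h) m = fps_nth h (Suc m) + a * fps_nth (fps_div_linear a h) (Suc m)"
      using div_linear_step[OF assms, of "Suc m" a] by (simp add: fps_div_linear_def)
    thus ?thesis using Suc by (simp add: algebra_simps)
  qed
qed

text \<open>Coefficient n of the quotient involves only coefficients of h beyond n. Bounding those
  alone is what lets dominance of an index survive division.\<close>

lemma div_linear_bound:
  assumes "entire (h :: 'a fps)" "r > 0" "absv a \<le> r" "\<And>k. k > n \<Longrightarrow> absv (fps_nth h k) * r ^ k \<le> M"
  shows "absv (fps_nth (fps_div_linear a h) n) * r ^ Suc n \<le> M"
proof -
  let ?u = "\<lambda>k. fps_nth h (Suc n + k) * a ^ k"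
  have M: "M \<ge> 0"
  proof -
    have "0 \<le> absv (fps_nth h (Suc n)) * r ^ Suc n" using assms(2) absv_nonneg by simp
    thus ?thesis using assms(4)[of "Suc n"] by linarith
  qed
  have "absv (?u k) \<le> M / r ^ Suc n" for k
  proof -
    have "absv (?u k) * r ^ Suc n \<le> absv (fps_nth h (Suc n + k)) * r ^ k * r ^ Suc n"
      using assms(2,3) by (auto simp: absv_mult intro!: mult_right_mono mult_left_mono power_mono absv_nonneg)
    also have "\<dots> = absv (fps_nth h (Suc n + k)) * r ^ (Suc n + k)" by (simp add: power_add)
    also have "\<dots> \<le> M" by (intro assms(4)) auto
    finally show ?thesis using assms(2) by (simp add: field_simps)
  qed
  hence "absv (\<Sum>k<m. ?u k) \<le> M / r ^ Suc n" for m
    using M assms(2) by (intro absv_sum_le) auto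
  moreover have "(\<lambda>m. \<Sum>k<m. ?u k) \<longlonglongrightarrow> fps_nth (fps_div_linear a h) n"
    using summable_sums[OF div_linear_summable[OF assms(1), of "Suc n" a]]
    by (simp add: sums_def fps_div_linear_def)
  ultimately have "absv (fps_nth (fps_div_linear a h) n) \<le> M / r ^ Suc n"
    by (rule absv_lim_le[rotated])
  thus ?thesis using assms(2) by (simp add: field_simps)
qed

lemma entire_div_linear: 
  assumes "entire (h :: 'a fps)" shows "entire (fps_div_linear a h)"
  unfolding entire_iff
proof (intro allI impI)
  fix r :: real assume r: "r > 0"
  \<comment> \<open>The bound for the quotient requires \<open>a\<close> to lie in the disc, so r is
    enlarged if necessary.\<close>
  define s where "s = max r (absv a)"
  have s: "s > 0" "absv a \<le> s" "r \<le> s" using r by (auto simp: s_def)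
  obtain C where C: "C \<ge> 0" "\<And>n. absv (fps_nth h n) * s ^ n \<le> C" using entire_bound[OF assms s(1)] by blast
  have "absv (fps_nth (fps_div_linear a h) n) * r ^ n \<le> C / s" for n
  proof -
    have "absv (fps_nth (fps_div_linear a h) n) * r ^ n \<le> absv (fps_nth (fps_div_linear a h) n) * s ^ n"
      using r s by (intro mult_left_mono power_mono absv_nonneg) auto
    also have "\<dots> \<le> C / s"
      using div_linear_bound[OF assms s(1,2) C(2)] s by (simp add: field_simps)
    finally show ?thesis .
  qed
  thus "\<exists>C. \<forall>n. absv (fps_nth (fps_div_linear a h) n) * r ^ n \<le> C" by blast
qed

lemma div_linearE:
  assumes "entire (h :: 'a fps)"
  obtains q where "entire (q :: 'a fps)" "h = (fps_X - fps_const a) * q + fps_const (fps_value h a)"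
  using entire_div_linear[OF assms] div_linear_eq[OF assms] by blast

lemma value_const [simp]: "fps_value (fps_const c) (a :: 'a) = c"
  by (rule value_eqI[of 0]) auto

lemma value_0 [simp]: "fps_value 0 (a :: 'a) = 0" and value_1 [simp]: "fps_value 1 (a :: 'a) = 1"
  using value_const[of 0 a] value_const[of 1 a] by simp_all

lemma value_X [simp]: "fps_value fps_X (a :: 'a) = a"
  by (rule value_eqI[of 1]) auto

lemma value_add [simp]:
  assumes "entire (h :: 'a fps)" "entire (l :: 'a fps)" shows "fps_value (h + l) a = fps_value h a + fps_value l a"
proof -
  obtain q1 q2 where q: "entire q1" "h = (fps_X - fps_const a) * q1 + fps_const (fps_value h a)"
    "entire q2" "l = (fps_X - fps_const a) * q2 + fps_const (fps_value l a)"
    using assms div_linearE by metis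
  show ?thesis
    by (rule value_eqI[of "q1 + q2"], use q in \<open>auto intro: entire_intros\<close>)
      (subst q(2), subst q(4), simp add: algebra_simps flip: fps_const_add)
qed

lemma value_mult [simp]:
  assumes "entire (h :: 'a fps)" "entire (l :: 'a fps)" shows "fps_value (h * l) a = fps_value h a * fps_value l a"
proof -
  define T where "T = fps_X - fps_const a"
  obtain q1 q2 where q: "entire q1" "h = T * q1 + fps_const (fps_value h a)"
    "entire q2" "l = T * q2 + fps_const (fps_value l a)"
    using assms div_linearE unfolding T_def by metis
  have "h * l = T * (q1 * l + fps_const (fps_value h a) * q2) + fps_const (fps_value h a * fps_value l a)"
  proof -
    have "h * l = T * (q1 * l) + fps_const (fps_value h a) * l"
      by (subst q(2)) (simp add: algebra_simps)
    also have "fps_const (fps_value h a) * l = T * (fps_const (fps_value h a) * q2)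
        + fps_const (fps_value h a * fps_value l a)"
      by (subst q(4)) (simp add: algebra_simps flip: fps_const_mult)
    finally show ?thesis by (simp add: algebra_simps)
  qed
  thus ?thesis using q assms unfolding T_def by (intro value_eqI) (auto intro!: entire_intros)
qed

lemma value_minus [simp]:
  assumes "entire (h :: 'a fps)" shows "fps_value (- h) a = - fps_value h a"
proof -
  have "fps_value (h + - h) a = fps_value h a + fps_value (- h) a"
    using assms by (intro value_add entire_minus)
  thus ?thesis by (simp add: eq_neg_iff_add_eq_0 add.commute)
qed

lemma value_diff [simp]: "entire (h :: 'a fps) \<Longrightarrow> entire (l :: 'a fps) \<Longrightarrow> fps_value (h - l) a = fps_value h a - fps_value l a"
  using value_add[of h "- l" a] by (simp add: entire_minus)

lemma value_power [simp]: "entire (h :: 'a fps) \<Longrightarrow> fps_value (h ^ n) a = fps_value h a ^ n"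
  by (induction n) (auto simp: entire_power)

lemma value_of_poly [simp]: "fps_value (fps_of_poly P) (a :: 'a) = poly P a"
  by (induction P) (auto simp: fps_of_poly_pCons entire_intros)

lemma value_0_iff:
  assumes "entire (h :: 'a fps)"
  shows "fps_value h a = 0 \<longleftrightarrow> (\<exists>q. entire (q :: 'a fps) \<and> h = (fps_X - fps_const a) * q)"
proof
  assume "fps_value h a = 0"
  thus "\<exists>q. entire q \<and> h = (fps_X - fps_const a) * q"
    using entire_div_linear[OF assms, of a] div_linear_eq[OF assms, of a] by auto
next
  assume "\<exists>q. entire q \<and> h = (fps_X - fps_const a) * q"
  then obtain q where "entire q" "h = (fps_X - fps_const a) * q" by blast
  thus "fps_value h a = 0" by (intro value_eqI[of q]) simp_all
qed

lemma value_deriv_linear: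
  assumes "entire (q :: 'a fps)" shows "fps_value (fps_deriv ((fps_X - fps_const a) * q)) a = fps_value q a"
  using assms by (simp add: entire_intros)

lemma value_bound:
  assumes "entire (h :: 'a fps)" "r > 0" "absv a \<le> r" "\<And>n. absv (fps_nth h n) * r ^ n \<le> C"
  shows "absv (fps_value h a) \<le> C"
proof -
  have "fps_value h a = fps_nth h 0 + a * fps_nth (fps_div_linear a h) 0"
    using div_linear_step[OF assms(1), of 0 a] by (simp add: fps_value_def)
  moreover have "absv (a * fps_nth (fps_div_linear a h) 0) \<le> C"
  proof -
    have "absv (a * fps_nth (fps_div_linear a h) 0) \<le> r * absv (fps_nth (fps_div_linear a h) 0)"
      unfolding absv_mult using assms(3) by (intro mult_right_mono absv_nonneg)
    also have "\<dots> \<le> C" using div_linear_bound[OF assms(1-4), of 0] by (simp add: mult_ac)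
    finally show ?thesis .
  qed
  ultimately show ?thesis using assms(4)[of 0] by (simp add: absv_add_le)
qed

subsection \<open>Gauss norms and zeros\<close>

text \<open>At the index found in \<open>ex_peak\<close>, the last one with a maximal term, this is
  the Weierstrass degree of h on the disc. Only later terms are compared because division by a
  linear factor never involves earlier ones; the uniform gap M, unlike strict inequalities term by
  term, survives infinite sums.\<close>

definition dominant :: "'a fps \<Rightarrow> real \<Rightarrow> nat \<Rightarrow> bool" where
  "dominant h r n \<longleftrightarrow> (\<exists>M. M < absv (fps_nth h n) * r ^ n \<and> (\<forall>k>n. absv (fps_nth h k) * r ^ k \<le> M))"

lemma ex_peak:
  assumes h: "entire h" "h \<noteq> 0" and r: "r > 0"
  obtains n where "dominant h r n" "\<And>k. absv (fps_nth h k) * r ^ k \<le> absv (fps_nth h n) * r ^ n"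
    "fps_nth h n \<noteq> 0"
proof -
  define c where "c = (\<lambda>n. absv (fps_nth h n) * r ^ n)"
  have lim: "c \<longlonglongrightarrow> 0" unfolding c_def by (rule entire_tendsto[OF h(1) r])
  have fin: "finite {n. e \<le> c n}" if e: "e > 0" for e
  proof -
    have "eventually (\<lambda>n. c n < e) sequentially" using lim e by (rule order_tendstoD)
    then obtain N where "\<And>n. n \<ge> N \<Longrightarrow> c n < e" by (auto simp: eventually_sequentially)
    hence "{n. e \<le> c n} \<subseteq> {..<N}" by (force simp: not_le[symmetric])
    thus ?thesis using finite_subset by blast
  qed
  obtain j where j: "fps_nth h j \<noteq> 0" using h(2) by (auto simp: fps_eq_iff)
  hence cj: "c j > 0" using r by (simp add: c_def)
  define S where "S = {n. c j \<le> c n}"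
  have S: "finite S" "j \<in> S" using fin[OF cj] by (auto simp: S_def)
  define m where "m = Max (c ` S)"
  have m: "c n \<le> m" for n
  proof (cases "n \<in> S")
    case True thus ?thesis using S by (auto simp: m_def)
  next
    case False
    hence "c n \<le> c j" by (auto simp: S_def)
    also have "c j \<le> m" using S by (auto simp: m_def)
    finally show ?thesis .
  qed
  have m0: "m > 0" using m[of j] cj by linarith
  have "m \<in> c ` S" unfolding m_def using S by (intro Max_in) auto
  then obtain i where i: "c i = m" by auto
  define n where "n = Max {i. m \<le> c i}"
  have fm: "finite {i. m \<le> c i}" by (rule fin[OF m0])
  have "n \<in> {i. m \<le> c i}" unfolding n_def using i by (intro Max_in fm) auto
  hence n: "c n = m" using m[of n] by auto
  have gt: "c k < m" if "k > n" for k
    using Max_ge[OF fm, of k] that unfolding n_def by (force simp: not_le[symmetric])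
  \<comment> \<open>Only finitely many later terms reach m / 2, and each is below m; m / 2 bounds
    all the others.\<close>
  define M where "M = Max (insert (m / 2) (c ` {k. k > n \<and> m / 2 \<le> c k}))"
  have fM: "finite (insert (m / 2) (c ` {k. k > n \<and> m / 2 \<le> c k}))"
    using finite_subset[OF _ fin[of "m / 2"], of "{k. k > n \<and> m / 2 \<le> c k}"] m0 by auto
  have "M < m" unfolding M_def using fM gt m0 by (subst Max_less_iff) auto
  moreover have "c k \<le> M" if "k > n" for k
  proof (cases "m / 2 \<le> c k")
    case True
    thus ?thesis unfolding M_def using fM that by (intro Max_ge) auto
  next
    case False
    hence "c k \<le> m / 2" by simp
    also have "m / 2 \<le> M" unfolding M_def using fM by (intro Max_ge) auto
    finally show ?thesis .
  qed
  ultimately have "dominant h r n" unfolding dominant_def using n by (auto simp: c_def)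
  moreover have "fps_nth h n \<noteq> 0" using n m0 by (auto simp: c_def)
  ultimately show ?thesis using m n that by (simp add: c_def)
qed

section \<open>Gauss norms and the splitting off of zeros\<close>

definition gauss_norm :: "'a fps \<Rightarrow> real \<Rightarrow> real" where
  "gauss_norm h r = (SUP n. absv (fps_nth h n) * r ^ n)"

lemma gauss_norm_ge:
  assumes "entire h" "r > 0" shows "absv (fps_nth h n) * r ^ n \<le> gauss_norm h r"
proof -
  obtain C where "\<And>n. absv (fps_nth h n) * r ^ n \<le> C" using entire_bound[OF assms] by blast
  thus ?thesis unfolding gauss_norm_def by (intro cSUP_upper) (auto intro!: bdd_aboveI)
qed

lemma gauss_norm_le:
  assumes "\<And>n. absv (fps_nth h n) * r ^ n \<le> C" shows "gauss_norm h r \<le> C"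
  unfolding gauss_norm_def using assms by (intro cSUP_least) auto

lemma gauss_norm_nonneg: "entire h \<Longrightarrow> r > 0 \<Longrightarrow> 0 \<le> gauss_norm h r"
  using gauss_norm_ge[of h r 0] absv_nonneg[of "fps_nth h 0"] by simp

lemma gauss_norm_pos:
  assumes "entire h" "h \<noteq> 0" "r > 0" shows "gauss_norm h r > 0"
proof -
  obtain n where "fps_nth h n \<noteq> 0" using assms(2) by (auto simp: fps_eq_iff)
  hence "0 < absv (fps_nth h n) * r ^ n" using assms(3) by simp
  also have "\<dots> \<le> gauss_norm h r" by (rule gauss_norm_ge[OF assms(1,3)])
  finally show ?thesis .
qed

lemma gauss_norm_0 [simp]: "gauss_norm 0 r = 0"
  by (simp add: gauss_norm_def)

lemma gauss_norm_add_le: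
  assumes "entire h" "entire l" "r > 0" "gauss_norm h r \<le> C" "gauss_norm l r \<le> C"
  shows "gauss_norm (h + l) r \<le> C"
proof (rule gauss_norm_le)
  fix n
  have "absv (fps_nth h n) \<le> C / r ^ n" "absv (fps_nth l n) \<le> C / r ^ n"
    using gauss_norm_ge[OF assms(1,3), of n] gauss_norm_ge[OF assms(2,3), of n] assms(3-5)
    by (auto simp: pos_le_divide_eq)
  hence "absv (fps_nth h n + fps_nth l n) \<le> C / r ^ n" by (rule absv_add_le)
  thus "absv (fps_nth (h + l) n) * r ^ n \<le> C" using assms(3) by (simp add: pos_le_divide_eq)
qed

lemma gauss_norm_minus [simp]: "gauss_norm (- h) r = gauss_norm h r"
  by (simp add: gauss_norm_def)

lemma gauss_norm_diff_le:
  assumes "entire h" "entire l" "r > 0" "gauss_norm h r \<le> C" "gauss_norm l r \<le> C"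
  shows "gauss_norm (h - l) r \<le> C"
  using gauss_norm_add_le[of h "- l" r C] assms by (simp add: entire_minus)

lemma gauss_norm_deriv_le:
  assumes "entire h" "r > 0" shows "gauss_norm (fps_deriv h) r \<le> gauss_norm h r / r"
  by (intro gauss_norm_le deriv_coeff_bound gauss_norm_ge assms)

lemma gauss_norm_mult_le:
  assumes "entire h" "entire l" "r > 0"
  shows "gauss_norm (h * l) r \<le> gauss_norm h r * gauss_norm l r"
  by (intro gauss_norm_le mult_coeff_bound gauss_norm_ge assms)

text \<open>Gauss's lemma. Let n and m be the last indices of maximal terms of h and l. In
  coefficient n + m of the product every summand except one has a factor beyond n or beyond m, so by
  the gaps the product of the two peaks strictly dominates.\<close>

lemma gauss_norm_mult:
  assumes h: "entire h" and l: "entire l" and r: "r > 0"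
  shows "gauss_norm (h * l) r = gauss_norm h r * gauss_norm l r"
proof (cases "h = 0 \<or> l = 0")
  case False
  obtain n where n: "dominant h r n" "\<And>k. absv (fps_nth h k) * r ^ k \<le> absv (fps_nth h n) * r ^ n"
    "fps_nth h n \<noteq> 0"
    using ex_peak[OF h _ r] False by blast
  obtain m where m: "dominant l r m" "\<And>k. absv (fps_nth l k) * r ^ k \<le> absv (fps_nth l m) * r ^ m"
    "fps_nth l m \<noteq> 0"
    using ex_peak[OF l _ r] False by blast
  obtain M1 where M1: "M1 < absv (fps_nth h n) * r ^ n" "\<And>k. k > n \<Longrightarrow> absv (fps_nth h k) * r ^ k \<le> M1"
    using n(1) by (auto simp: dominant_def)
  obtain M2 where M2: "M2 < absv (fps_nth l m) * r ^ m" "\<And>k. k > m \<Longrightarrow> absv (fps_nth l k) * r ^ k \<le> M2"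
    using m(1) by (auto simp: dominant_def)
  define H where "H = absv (fps_nth h n) * r ^ n"
  define L where "L = absv (fps_nth l m) * r ^ m"
  have HL: "H > 0" "L > 0" using n(3) m(3) r by (auto simp: H_def L_def)
  have "0 \<le> absv (fps_nth h (Suc n)) * r ^ Suc n" "0 \<le> absv (fps_nth l (Suc m)) * r ^ Suc m"
    using absv_nonneg r by simp_all
  hence M0: "M1 \<ge> 0" "M2 \<ge> 0" using M1(2)[of "Suc n"] M2(2)[of "Suc m"] by linarith+
  define B where "B = max (M1 * L) (H * M2)"
  have "M1 * L < H * L" "H * M2 < H * L"
    using HL M1(1) M2(1) by (simp_all flip: H_def L_def)
  moreover have "0 \<le> M1 * L" using M0 HL by simp
  ultimately have B: "B < H * L" "B \<ge> 0" unfolding B_def by (simp_all add: le_max_iff_disj)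
  have "fps_nth (h * l) (n + m) = fps_nth h n * fps_nth l m
      + (\<Sum>i\<in>{0..n+m} - {n}. fps_nth h i * fps_nth l (n + m - i))"
    unfolding fps_mult_nth by (subst sum.remove[of _ n]) auto
  moreover have "absv (\<Sum>i\<in>{0..n+m} - {n}. fps_nth h i * fps_nth l (n + m - i)) \<le> B / r ^ (n + m)"
  proof (rule absv_sum_le)
    fix i assume i: "i \<in> {0..n+m} - {n}"
    have "absv (fps_nth h i * fps_nth l (n + m - i)) * r ^ (n + m)
        = (absv (fps_nth h i) * r ^ i) * (absv (fps_nth l (n + m - i)) * r ^ (n + m - i))"
      using i by (simp add: absv_mult mult_ac flip: power_add)
    also have "\<dots> \<le> B"
    proof (cases "i > n")
      case True
      have "(absv (fps_nth h i) * r ^ i) * (absv (fps_nth l (n + m - i)) * r ^ (n + m - i)) \<le> M1 * L"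
        unfolding L_def using M0 r absv_nonneg by (intro mult_mono M1(2) True m(2)) auto
      thus ?thesis by (simp add: B_def)
    next
      case False
      hence "n + m - i > m" using i by auto
      hence "(absv (fps_nth h i) * r ^ i) * (absv (fps_nth l (n + m - i)) * r ^ (n + m - i)) \<le> H * M2"
        using HL r absv_nonneg by (intro mult_mono M2(2)) (auto simp: H_def n(2))
      thus ?thesis by (simp add: B_def)
    qed
    finally show "absv (fps_nth h i * fps_nth l (n + m - i)) \<le> B / r ^ (n + m)"
      using r by (simp add: pos_le_divide_eq)
  qed (use B r in auto)
  moreover have "B / r ^ (n + m) < absv (fps_nth h n * fps_nth l m)"
    using B(1) r by (simp add: pos_divide_less_eq H_def L_def absv_mult power_add mult_ac)
  ultimately have "absv (fps_nth (h * l) (n + m)) = absv (fps_nth h n * fps_nth l m)"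
    by (simp add: absv_add_eq)
  hence "H * L = absv (fps_nth (h * l) (n + m)) * r ^ (n + m)"
    by (simp add: H_def L_def absv_mult power_add mult_ac)
  also have "\<dots> \<le> gauss_norm (h * l) r" by (intro gauss_norm_ge entire_mult h l r)
  finally have "H * L \<le> gauss_norm (h * l) r" .
  moreover have "gauss_norm h r * gauss_norm l r \<le> H * L"
    using HL n(2) m(2) h l r by (intro mult_mono gauss_norm_le gauss_norm_nonneg) (auto simp: H_def L_def)
  ultimately show ?thesis using gauss_norm_mult_le[OF h l r] by linarith
qed auto

lemma gauss_norm_const [simp]: "r > 0 \<Longrightarrow> gauss_norm (fps_const c) r = absv c"
  using gauss_norm_ge[of "fps_const c" r 0] absv_nonneg[of c]
    gauss_norm_le[of "fps_const c" r "absv c"] by force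

lemma gauss_norm_linear:
  assumes "r > 0" "absv a \<le> r" shows "gauss_norm (fps_X - fps_const a) r = r"
proof (rule antisym)
  show "gauss_norm (fps_X - fps_const a) r \<le> r"
  proof (rule gauss_norm_le)
    fix n show "absv (fps_nth (fps_X - fps_const a) n) * r ^ n \<le> r"
      using assms by (cases n) (auto simp: fps_X_def)
  qed
  show "r \<le> gauss_norm (fps_X - fps_const a) r"
    using gauss_norm_ge[of "fps_X - fps_const a" r 1] assms by simp
qed

lemma gauss_norm_power:
  "entire h \<Longrightarrow> r > 0 \<Longrightarrow> gauss_norm (h ^ n) r = gauss_norm h r ^ n"
proof (induction n)
  case 0
  show ?case using gauss_norm_const[OF \<open>r > 0\<close>, of 1] by simp
qed (simp add: gauss_norm_mult entire_power)

lemma value_le_gauss_norm: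
  "entire h \<Longrightarrow> r > 0 \<Longrightarrow> absv a \<le> r \<Longrightarrow> absv (fps_value h a) \<le> gauss_norm h r"
  by (rule value_bound) (auto intro: gauss_norm_ge)

lemma dominant_0_no_zero:
  assumes h: "entire h" and r: "r > 0" "absv a \<le> r" and dom: "dominant h r 0"
  shows "fps_value h a \<noteq> 0"
proof -
  obtain M where M: "M < absv (fps_nth h 0)" "\<And>k. k > 0 \<Longrightarrow> absv (fps_nth h k) * r ^ k \<le> M"
    using dom by (auto simp: dominant_def)
  have "absv (a * fps_nth (fps_div_linear a h) 0) \<le> r * absv (fps_nth (fps_div_linear a h) 0)"
    unfolding absv_mult using r by (intro mult_right_mono absv_nonneg)
  also have "\<dots> \<le> M" using div_linear_bound[OF h r M(2), of 0] by (simp add: mult_ac)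
  finally have "absv (fps_nth h 0 + a * fps_nth (fps_div_linear a h) 0) = absv (fps_nth h 0)"
    using M(1) by (intro absv_add_eq) auto
  moreover have "fps_value h a = fps_nth h 0 + a * fps_nth (fps_div_linear a h) 0"
    using div_linear_step[OF h, of 0 a] by (simp add: fps_value_def)
  moreover have "M \<ge> 0"
  proof -
    have "0 \<le> absv (fps_nth h 1) * r ^ 1" using r absv_nonneg by simp
    thus ?thesis using M(2)[of 1] by linarith
  qed
  ultimately show ?thesis using M(1) absv_0 by fastforce
qed

text \<open>The dominant index is the induction measure whenever zeros in a disc are split off. The
  point \<open>a\<close> is arbitrary in the disc, zero or not, so that divided differences are
  covered as well.\<close>

lemma dominant_div_linear:
  assumes h: "entire h" and r: "r > 0" "absv a \<le> r" and dom: "dominant h r (Suc n)"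
  shows "dominant (fps_div_linear a h) r n"
    and "absv (fps_nth (fps_div_linear a h) n) = absv (fps_nth h (Suc n))"
proof -
  let ?q = "fps_div_linear a h"
  obtain M where M: "M < absv (fps_nth h (Suc n)) * r ^ Suc n"
    "\<And>k. k > Suc n \<Longrightarrow> absv (fps_nth h k) * r ^ k \<le> M"
    using dom by (auto simp: dominant_def)
  have q: "absv (fps_nth ?q k) * r ^ k \<le> M / r" if "k > n" for k
  proof -
    have "absv (fps_nth ?q k) * r ^ Suc k \<le> M"
      using that by (intro div_linear_bound[OF h r] M(2)) auto
    thus ?thesis using r by (simp add: pos_le_divide_eq mult_ac)
  qed
  have "absv (a * fps_nth ?q (Suc n)) * r ^ Suc n \<le> r * (absv (fps_nth ?q (Suc n)) * r ^ Suc n)"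
    using r by (auto simp: absv_mult mult_ac intro!: mult_left_mono mult_right_mono absv_nonneg)
  also have "\<dots> \<le> r * (M / r)" using r q[of "Suc n"] by (intro mult_left_mono) auto
  also have "\<dots> < absv (fps_nth h (Suc n)) * r ^ Suc n" using M r by simp
  finally have "absv (a * fps_nth ?q (Suc n)) < absv (fps_nth h (Suc n))" using r by simp
  hence "absv (fps_nth h (Suc n) + a * fps_nth ?q (Suc n)) = absv (fps_nth h (Suc n))"
    by (rule absv_add_eq)
  moreover have "fps_nth ?q n = fps_nth h (Suc n) + a * fps_nth ?q (Suc n)"
    using div_linear_step[OF h, of "Suc n" a] by (simp add: fps_div_linear_def)
  ultimately show *: "absv (fps_nth ?q n) = absv (fps_nth h (Suc n))" by simp
  have "M / r < absv (fps_nth ?q n) * r ^ n"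
    using M r unfolding * by (simp add: pos_divide_less_eq mult_ac)
  with q show "dominant ?q r n" unfolding dominant_def by blast
qed

text \<open>The \<open>n\<close>-th divided difference of \<open>h\<close> at \<open>n + 1\<close> points of the disc has the absolute value of
  the dominant coefficient.\<close>
lemma separated_points_bound:
  assumes "entire h" "r > 0" "dominant h r n" "\<eta> > 0" "finite S" "card S = Suc n"
    "\<And>x. x \<in> S \<Longrightarrow> absv x \<le> r" "\<And>x. x \<in> S \<Longrightarrow> absv (fps_value h x) \<le> \<epsilon>"
    "\<And>x y. x \<in> S \<Longrightarrow> y \<in> S \<Longrightarrow> x \<noteq> y \<Longrightarrow> \<eta> \<le> absv (x - y)"
  shows "absv (fps_nth h n) * \<eta> ^ n \<le> \<epsilon>"
  using assms
proof (induction n arbitrary: h S \<epsilon>)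
  case 0
  then obtain x where S: "S = {x}" by (auto simp: card_Suc_eq)
  obtain M where M: "M < absv (fps_nth h 0)" "\<And>k. k > 0 \<Longrightarrow> absv (fps_nth h k) * r ^ k \<le> M"
    using 0(3) by (auto simp: dominant_def)
  have x: "absv x \<le> r" using 0(7) S by blast
  have "absv (x * fps_nth (fps_div_linear x h) 0) \<le> r * absv (fps_nth (fps_div_linear x h) 0)"
    unfolding absv_mult using x by (intro mult_right_mono absv_nonneg)
  also have "\<dots> \<le> M" using div_linear_bound[OF 0(1,2) x M(2), of 0] by (simp add: mult_ac)
  finally have "absv (fps_nth h 0 + x * fps_nth (fps_div_linear x h) 0) = absv (fps_nth h 0)"
    using M(1) by (intro absv_add_eq) auto
  moreover have "fps_value h x = fps_nth h 0 + x * fps_nth (fps_div_linear x h) 0"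
    using div_linear_step[OF 0(1), of 0 x] by (simp add: fps_value_def)
  ultimately show ?case using 0(8)[of x] S by simp
next
  case (Suc n)
  then obtain x where x: "x \<in> S" by fastforce
  let ?q = "fps_div_linear x h"
  have xr: "absv x \<le> r" using Suc x by blast
  note dom = dominant_div_linear[OF Suc(2,3) xr Suc(4)]
  have q: "entire ?q" by (rule entire_div_linear[OF Suc(2)])
  have "absv (fps_nth ?q n) * \<eta> ^ n \<le> \<epsilon> / \<eta>"
  proof (rule Suc.IH[OF q Suc(3) dom(1) Suc(5), of "S - {x}"])
    fix y assume y: "y \<in> S - {x}"
    have "fps_value h y = fps_value ((fps_X - fps_const x) * ?q + fps_const (fps_value h x)) y"
      by (subst (1) div_linear_eq[OF Suc(2), of x]) simp
    hence "fps_value h y - fps_value h x = (y - x) * fps_value ?q y"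
      using q by (simp add: entire_mult)
    moreover have "absv (fps_value h y - fps_value h x) \<le> \<epsilon>"
      using Suc x y by (intro absv_diff_le) auto
    ultimately have "absv (y - x) * absv (fps_value ?q y) \<le> \<epsilon>" by (simp add: absv_mult)
    moreover have "\<eta> * absv (fps_value ?q y) \<le> absv (y - x) * absv (fps_value ?q y)"
      using Suc.prems(9)[of y x] x y by (intro mult_right_mono absv_nonneg) auto
    ultimately show "absv (fps_value ?q y) \<le> \<epsilon> / \<eta>" using Suc(5) by (simp add: pos_le_divide_eq mult_ac)
  qed (use Suc x in auto)
  thus ?case unfolding dom(2) using Suc(5) by (simp add: pos_le_divide_eq mult_ac)
qed

lemma ex_maximal_card:
  assumes "\<And>S. P S \<Longrightarrow> finite S \<and> card S \<le> n" "P {}"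
  obtains S where "P S" "finite S" "\<And>T. P T \<Longrightarrow> card T \<le> card S"
proof -
  have "\<exists>S. P S \<and> (\<forall>T. P T \<longrightarrow> card T \<le> card S)"
    using ex_has_greatest_nat[of P "{}" card "Suc n"] assms by (auto simp: less_Suc_eq_le)
  thus ?thesis using assms(1) that by blast
qed

text \<open>By the previous bound, a sequence of points at which \<open>h\<close> tends to \<open>0\<close> is totally bounded.\<close>
lemma approximate_zeros_imp_zero:
  assumes h: "entire h" "h \<noteq> 0" and r: "r > 0"
    and approx: "\<And>\<epsilon>. \<epsilon> > 0 \<Longrightarrow> \<exists>x. absv x \<le> r \<and> absv (fps_value h x) \<le> \<epsilon>"
  shows "\<exists>x. absv x \<le> r \<and> fps_value h x = 0"
proof -
  obtain n where n: "dominant h r n" "fps_nth h n \<noteq> 0" using ex_peak[OF h r] by blast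
  obtain X where X: "\<And>i. absv (X i) \<le> r" "\<And>i. absv (fps_value h (X i)) \<le> 1 / real (Suc i)"
    using approx[of "1 / real (Suc _)"] by (metis of_nat_0_less_iff zero_less_Suc zero_less_divide_1_iff)
  have cover: "\<exists>K. finite K \<and> range X \<subseteq> (\<Union>x\<in>K. ball x e)" if e: "e > 0" for e
  proof -
    \<comment> \<open>Half the lower bound from \<open>separated_points_bound\<close>: n + 1 points
      at mutual distance at least e cannot all have values of size at most \<epsilon>.\<close>
    define \<epsilon> where "\<epsilon> = absv (fps_nth h n) * e ^ n / 2"
    have \<epsilon>: "\<epsilon> > 0" "\<epsilon> < absv (fps_nth h n) * e ^ n" using n(2) e by (auto simp: \<epsilon>_def)
    obtain N where N: "1 / real (Suc N) < \<epsilon>" using \<epsilon>(1) nat_approx_posE by blast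
    define U where "U = X ` {N..}"
    have U: "absv x \<le> r" "absv (fps_value h x) \<le> \<epsilon>" if "x \<in> U" for x
    proof -
      from that obtain i where i: "i \<ge> N" "x = X i" by (auto simp: U_def)
      have "absv (fps_value h x) \<le> 1 / real (Suc i)" using X i by simp
      also have "\<dots> \<le> 1 / real (Suc N)" using i by (simp add: field_simps)
      finally show "absv x \<le> r" "absv (fps_value h x) \<le> \<epsilon>" using N X i by auto
    qed
    define P where "P = (\<lambda>S. finite S \<and> S \<subseteq> U \<and> (\<forall>x\<in>S. \<forall>y\<in>S. x \<noteq> y \<longrightarrow> e \<le> absv (x - y)))"
    have card: "finite S \<and> card S \<le> n" if "P S" for S
    proof (rule ccontr)
      assume "\<not> (finite S \<and> card S \<le> n)"
      with that have "Suc n \<le> card S" by (auto simp: P_def)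
      then obtain T where T: "T \<subseteq> S" "card T = Suc n" "finite T" by (rule obtain_subset_with_card_n)
      have "absv (fps_nth h n) * e ^ n \<le> \<epsilon>"
        using T that by (intro separated_points_bound[OF h(1) r n(1) e T(3,2)]) (auto simp: P_def intro!: U)
      with \<epsilon> show False by linarith
    qed
    have "P {}" by (simp add: P_def)
    with card obtain S where S: "P S" "finite S" "\<And>T. P T \<Longrightarrow> card T \<le> card S"
      using ex_maximal_card[of P n] by metis
    have "\<exists>x\<in>S. dist x u < e" if u: "u \<in> U" for u
    proof (rule ccontr)
      assume *: "\<not> (\<exists>x\<in>S. dist x u < e)"
      hence "u \<notin> S" using e by auto
      moreover have "P (insert u S)"
        using * S(1) u by (auto simp: P_def dist_absv not_less absv_minus_commute)
      ultimately show False using S(3)[of "insert u S"] S(2) by simp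
    qed
    hence "range X \<subseteq> (\<Union>x\<in>S \<union> X ` {..<N}. ball x e)"
      using e unfolding U_def by (force simp: not_less)
    thus ?thesis using S(2) by (intro exI[of _ "S \<union> X ` {..<N}"]) auto
  qed
  have "compact (closure (range X))"
    unfolding compact_eq_totally_bounded
  proof (intro conjI allI impI)
    show "complete (closure (range X))" by (simp add: complete_eq_closed)
    fix e :: real assume e: "e > 0"
    then obtain K where K: "finite K" "range X \<subseteq> (\<Union>x\<in>K. ball x (e / 2))" using cover[of "e / 2"] by auto
    have "closure (range X) \<subseteq> (\<Union>x\<in>K. cball x (e / 2))"
      using K by (intro closure_minimal closed_UN) (auto simp: subset_eq intro: less_imp_le)
    also have "\<dots> \<subseteq> (\<Union>x\<in>K. ball x e)" using e by (force simp: subset_eq)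
    finally show "\<exists>k. finite k \<and> closure (range X) \<subseteq> (\<Union>x\<in>k. ball x e)" using K(1) by blast
  qed
  hence "seq_compact (closure (range X))" by (simp add: compact_eq_seq_compact_metric)
  moreover have "\<forall>n. X n \<in> closure (range X)" by (simp add: subsetD[OF closure_subset])
  ultimately obtain L s where s: "strict_mono s" "(X \<circ> s) \<longlonglongrightarrow> L"
    unfolding seq_compact_def by blast
  have L: "absv L \<le> r" using X(1) by (intro absv_lim_le[OF s(2)]) simp
  \<comment> \<open>The quotient by X - L is bounded on the disc, which gives a Lipschitz constant
    of h at L.\<close>
  define C where "C = gauss_norm (fps_div_linear L h) r"
  have bd: "absv (fps_value h L) \<le> C * absv ((X \<circ> s) i - L) + 1 / real (Suc i)" for i
  proof -
    let ?x = "X (s i)" and ?q = "fps_div_linear L h"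
    have q: "entire ?q" by (rule entire_div_linear[OF h(1)])
    have "fps_value h ?x = fps_value ((fps_X - fps_const L) * ?q + fps_const (fps_value h L)) ?x"
      by (subst (1) div_linear_eq[OF h(1), of L]) simp
    hence "fps_value h L = fps_value h ?x - (?x - L) * fps_value ?q ?x"
      using q by (simp add: entire_mult)
    moreover have "absv ((?x - L) * fps_value ?q ?x) \<le> C * absv (?x - L)"
      unfolding absv_mult C_def using X(1)
      by (subst mult.commute) (intro mult_right_mono absv_nonneg value_le_gauss_norm[OF q r])
    moreover have "absv (fps_value h ?x) \<le> 1 / real (Suc i)"
    proof -
      have "absv (fps_value h ?x) \<le> 1 / real (Suc (s i))" by (rule X(2))
      also have "\<dots> \<le> 1 / real (Suc i)" using seq_suble[OF s(1), of i] by (simp add: field_simps)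
      finally show ?thesis .
    qed
    moreover have "0 \<le> 1 / real (Suc i)" "0 \<le> C * absv (?x - L)"
      using absv_nonneg gauss_norm_nonneg[OF q r] by (auto simp: C_def)
    ultimately show ?thesis unfolding o_def by (metis absv_diff_le add_increasing add_increasing2)
  qed
  have "(\<lambda>i. C * absv ((X \<circ> s) i - L) + 1 / real (Suc i)) \<longlonglongrightarrow> C * 0 + 0"
    using s(2)[unfolded tendsto_iff_absv]
    by (intro tendsto_add tendsto_mult tendsto_const LIMSEQ_Suc[OF lim_1_over_n])
  hence "absv (fps_value h L) \<le> 0"
    using bd by (intro LIMSEQ_le_const[of _ "C * 0 + 0", simplified]) auto
  hence "fps_value h L = 0" using absv_nonneg[of "fps_value h L"] by (simp flip: absv_eq_0_iff)
  with L show ?thesis by blast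
qed

section \<open>Algebraic closedness\<close>

lemma algebraic_over_0_1: "algebraic_over (closure \<rat>) (0 :: 'a)" "algebraic_over (closure \<rat>) (1 :: 'a)"
proof -
  have Q: "x \<in> closure \<rat>" if "x \<in> \<rat>" for x :: 'a using that closure_subset by blast
  show "algebraic_over (closure \<rat>) (0 :: 'a)" unfolding algebraic_over_def
    by (rule exI[of _ "[:0, 1:]"]) (auto simp: coeff_pCons split: nat.splits intro!: Q)
  show "algebraic_over (closure \<rat>) (1 :: 'a)" unfolding algebraic_over_def
    by (rule exI[of _ "[:-1, 1:]"]) (auto simp: coeff_pCons split: nat.splits intro!: Q)
qed

lemma ex_algebraic_approx:
  assumes "\<epsilon> > 0" shows "\<exists>x :: 'a. algebraic_over (closure \<rat>) x \<and> absv (x - y) < \<epsilon>"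
proof -
  have "y \<in> closure {x :: 'a. algebraic_over (closure \<rat>) x}"
    by (simp add: algebraic_closure_dense)
  thus ?thesis using assms unfolding closure_approachable by (auto simp: dist_absv)
qed

text \<open>This keeps the roots of all approximating polynomials below in one fixed disc.\<close>

lemma monic_poly_root_bound:
  assumes "degree P = d" "coeff P d = 1" "d > 0" "R \<ge> 1" "\<And>i. absv (coeff P i) \<le> R" "poly P x = 0"
  shows "absv x \<le> R"
proof (rule ccontr)
  assume "\<not> absv x \<le> R"
  hence x: "absv x > R" "absv x > 1" using assms(4) by auto
  obtain e where e: "d = Suc e" using assms(3) by (cases d) auto
  have "x ^ d + (\<Sum>i<d. coeff P i * x ^ i) = 0"
    using assms(1,2,6) by (simp add: poly_altdef add.commute flip: lessThan_Suc_atMost)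
  hence "x ^ d = - (\<Sum>i<d. coeff P i * x ^ i)" by (simp add: eq_neg_iff_add_eq_0)
  hence "absv (x ^ d) = absv (\<Sum>i<d. coeff P i * x ^ i)" by (simp only: absv_minus)
  also have "\<dots> \<le> R * absv x ^ e"
  proof (rule absv_sum_le)
    fix i assume "i \<in> {..<d}"
    hence "i \<le> e" using e by auto
    thus "absv (coeff P i * x ^ i) \<le> R * absv x ^ e"
      unfolding absv_mult absv_power using x assms(4,5)
      by (intro mult_mono power_increasing) (auto simp: absv_nonneg)
  qed (use x assms(4) in auto)
  finally have "absv x * absv x ^ e \<le> R * absv x ^ e" by (simp add: e absv_mult)
  moreover have "R * absv x ^ e < absv x * absv x ^ e"
    using x by (intro mult_strict_right_mono zero_less_power) linarith+
  ultimately show False by linarith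
qed

text \<open>The coefficients of a monic polynomial are approximated by algebraic ones. Roots of the
  approximations exist by assumption and are approximate roots of the given polynomial in a common
  disc, so \<open>approximate_zeros_imp_zero\<close> yields an exact root; continuity of roots is
  not invoked.\<close>

lemma algebraically_closed:
  fixes P :: "'a poly"
  assumes "degree P > 0" shows "\<exists>x. poly P x = 0"
proof -
  define d where "d = degree P"
  have lc: "coeff P d \<noteq> 0" using assms by (auto simp: d_def)
  define Q where "Q = smult (inverse (coeff P d)) P"
  have Q: "degree Q = d" "coeff Q d = 1" using lc by (auto simp: Q_def d_def)
  \<comment> \<open>R bounds the coefficients of Q even after perturbations of size at most 1, hence
    also the roots of the perturbed monic polynomials.\<close>
  define R where "R = Max (insert 1 ((\<lambda>i. absv (coeff Q i) + 1) ` {..d}))"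
  have R1: "R \<ge> 1" unfolding R_def by (intro Max_ge) auto
  have RQ: "absv (coeff Q i) + 1 \<le> R" for i
  proof (cases "i \<le> d")
    case True thus ?thesis unfolding R_def by (intro Max_ge) auto
  next
    case False thus ?thesis using R1 Q(1) by (simp add: coeff_eq_0)
  qed
  have "\<exists>x. absv x \<le> R \<and> absv (fps_value (fps_of_poly Q) x) \<le> \<epsilon>" if \<epsilon>: "\<epsilon> > 0" for \<epsilon>
  proof -
    define \<delta> where "\<delta> = min 1 (\<epsilon> / R ^ d)"
    have \<delta>: "\<delta> > 0" "\<delta> \<le> 1" "\<delta> * R ^ d \<le> \<epsilon>" using \<epsilon> R1 by (auto simp: \<delta>_def min_def field_simps)
    obtain c where c: "\<And>i. algebraic_over (closure \<rat>) (c i)" "\<And>i. absv (c i - coeff Q i) < \<delta>"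
      using ex_algebraic_approx[OF \<delta>(1)] choice[of "\<lambda>i x. algebraic_over (closure \<rat>) x \<and> absv (x - coeff Q i) < \<delta>"]
      by auto
    define A where "A = monom 1 d + (\<Sum>i<d. monom (c i) i)"
    have cA: "coeff A i = (if i = d then 1 else if i < d then c i else 0)" for i
      by (auto simp: A_def coeff_sum)
    have "degree A = d"
    proof (rule antisym)
      show "degree A \<le> d" by (rule degree_le) (auto simp: cA)
      show "d \<le> degree A" by (rule le_degree) (auto simp: cA)
    qed
    have diff: "absv (coeff A i - coeff Q i) \<le> \<delta>" for i
      using c(2)[of i] Q \<delta> by (cases i d rule: linorder_cases) (auto simp: cA coeff_eq_0)
    have "algebraic_over (closure \<rat>) (coeff A i)" for i
      using c(1) algebraic_over_0_1 by (simp add: cA)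
    with \<open>degree A = d\<close> assms obtain x where x: "poly A x = 0"
      using algebraic_closure_closed[of A] by (auto simp: d_def)
    have "absv (coeff A i) \<le> R" for i
    proof -
      have "absv (coeff Q i + (coeff A i - coeff Q i)) \<le> R"
        using RQ[of i] diff[of i] \<delta> R1 absv_nonneg[of "coeff Q i"] by (intro absv_add_le) auto
      thus ?thesis by simp
    qed
    hence xR: "absv x \<le> R"
      using assms monic_poly_root_bound[OF \<open>degree A = d\<close> _ _ R1 _ x] by (simp add: cA d_def)
    have "poly A x - poly Q x = (\<Sum>i\<le>d. (coeff A i - coeff Q i) * x ^ i)"
      using Q(1) \<open>degree A = d\<close> by (simp add: poly_altdef sum_subtractf algebra_simps)
    also have "absv \<dots> \<le> \<delta> * R ^ d"
    proof (rule absv_sum_le)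
      fix i assume "i \<in> {..d}"
      hence "absv x ^ i \<le> R ^ i" "R ^ i \<le> R ^ d" 
        using R1 xR absv_nonneg by (auto intro: power_mono power_increasing)
      thus "absv ((coeff A i - coeff Q i) * x ^ i) \<le> \<delta> * R ^ d"
        unfolding absv_mult absv_power using \<delta> diff absv_nonneg R1 by (intro mult_mono) auto
    qed (use \<delta> R1 in auto)
    finally have "absv (poly Q x) \<le> \<epsilon>" using \<delta>(3) x by simp
    with xR show ?thesis by auto
  qed
  moreover have "fps_of_poly Q \<noteq> 0" using Q by auto
  ultimately obtain x where "poly Q x = 0"
    using approximate_zeros_imp_zero[of "fps_of_poly Q" R] R1 by auto
  thus ?thesis using lc by (auto simp: Q_def)
qed

section \<open>Functions without zeros in a disc\<close>

lemma poly_no_zero_coeff_less: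
  assumes "P \<noteq> 0" "r > 0" "\<And>x. absv x \<le> r \<Longrightarrow> poly P x \<noteq> 0" "n > 0"
  shows "absv (coeff P n) * r ^ n < absv (coeff P 0)"
  using assms
proof (induction "degree P" arbitrary: P n)
  case 0
  hence "coeff P n = 0" "coeff P 0 \<noteq> 0" using leading_coeff_0_iff[of P] by (auto simp: coeff_eq_0)
  thus ?case by simp
next
  case (Suc d)
  \<comment> \<open>Since |b| > r, the constant term of the factor X - b is dominant on the disc,
    and so is that of Q by induction; the product inherits this.\<close>
  obtain b where "poly P b = 0" using algebraically_closed[of P] Suc(2) by auto
  then obtain Q where Q: "P = [:-b, 1:] * Q" by (auto simp: poly_eq_0_iff_dvd elim: dvdE)
  have b: "absv b > r" using Suc.prems(3)[of b] \<open>poly P b = 0\<close> by force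
  have Q0: "Q \<noteq> 0" using Suc.prems(1) Q by auto
  have dQ: "d = degree Q" using Suc(2) Q0 unfolding Q by (subst (asm) degree_mult_eq) auto
  have nzQ: "poly Q x \<noteq> 0" if "absv x \<le> r" for x using Suc.prems(3)[OF that] Q by auto
  have IH: "absv (coeff Q k) * r ^ k < absv (coeff Q 0)" if "k > 0" for k
    using Suc.hyps(1)[OF dQ Q0 Suc.prems(2) nzQ that] by simp
  have q0: "coeff Q 0 \<noteq> 0"
    using nzQ[of 0] Suc.prems(2) by (simp add: poly_0_coeff_0)
  have P0: "coeff P 0 = - b * coeff Q 0" by (simp add: Q coeff_mult)
  obtain m where m: "n = Suc m" using Suc.prems(4) by (cases n) auto
  have Pn: "coeff P n = coeff Q m - b * coeff Q n" by (simp add: Q m)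
  have le: "absv (coeff Q m) * r ^ m \<le> absv (coeff Q 0)"
    using IH[of m] by (cases "m = 0") auto
  have "absv (coeff Q m) * r ^ n \<le> absv (coeff Q 0) * r"
    using le Suc.prems(2) by (simp add: m mult_ac)
  also have "\<dots> < absv (coeff P 0)" using b q0 by (simp add: P0 absv_mult mult_ac)
  finally have 1: "absv (coeff Q m) < absv (coeff P 0) / r ^ n"
    using Suc.prems(2) by (simp add: pos_less_divide_eq)
  have "absv (b * coeff Q n) * r ^ n < absv (coeff P 0)"
    using mult_strict_left_mono[OF IH[OF Suc.prems(4)] less_trans[OF Suc.prems(2) b]]
    by (simp add: P0 absv_mult mult.assoc)
  hence 2: "absv (b * coeff Q n) < absv (coeff P 0) / r ^ n"
    using Suc.prems(2) by (simp add: pos_less_divide_eq)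
  have "absv (coeff P n) \<le> max (absv (coeff Q m)) (absv (b * coeff Q n))"
    unfolding Pn by (rule absv_diff_le) auto
  hence "absv (coeff P n) < absv (coeff P 0) / r ^ n" using 1 2 by auto
  thus ?case using Suc.prems(2) by (simp add: pos_less_divide_eq)
qed

text \<open>A zero-free h stays above some \<epsilon> > 0 on the disc, for otherwise approximate
  zeros would produce a zero. A truncation that is \<epsilon>-close to h is then zero-free too, and
  the polynomial case applies. Truncating at \<open>N + n\<close> also retains coefficient
  n.\<close>

lemma no_zero_coeff_less:
  assumes h: "entire h" and r: "r > 0" and nz: "\<And>x. absv x \<le> r \<Longrightarrow> fps_value h x \<noteq> 0" and n: "n > 0"
  shows "absv (fps_nth h n) * r ^ n < absv (fps_nth h 0)"
proof -
  have h0: "h \<noteq> 0" using nz[of 0] r by auto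
  obtain \<epsilon> where \<epsilon>: "\<epsilon> > 0" "\<And>x. absv x \<le> r \<Longrightarrow> \<epsilon> < absv (fps_value h x)"
    using approximate_zeros_imp_zero[OF h h0 r] nz by (meson not_le)
  have "eventually (\<lambda>n. absv (fps_nth h n) * r ^ n < \<epsilon>) sequentially"
    using entire_tendsto[OF h r] \<epsilon>(1) by (rule order_tendstoD)
  then obtain N where N: "\<And>n. n \<ge> N \<Longrightarrow> absv (fps_nth h n) * r ^ n < \<epsilon>"
    by (auto simp: eventually_sequentially)
  define P where "P = (\<Sum>i\<le>N + n. monom (fps_nth h i) i)"
  have cP: "coeff P i = (if i \<le> N + n then fps_nth h i else 0)" for i
    by (auto simp: P_def coeff_sum)
  have nzP: "poly P x \<noteq> 0" if x: "absv x \<le> r" for x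
  proof -
    have "absv (fps_nth (h - fps_of_poly P) i) * r ^ i \<le> \<epsilon>" for i
      using N[of i] \<epsilon>(1) by (auto simp: cP less_imp_le)
    hence "absv (fps_value (h - fps_of_poly P) x) \<le> \<epsilon>"
      using h x r by (intro value_bound) (auto intro: entire_diff)
    hence "absv (fps_value h x - poly P x) \<le> \<epsilon>" using h by simp
    with \<epsilon>(2)[OF x] show ?thesis by auto
  qed
  have "P \<noteq> 0" using nzP[of 0] r by auto
  from poly_no_zero_coeff_less[OF this r nzP n] show ?thesis by (simp add: cP)
qed

text \<open>Dominance of the constant term passes through the recursion for the coefficients of 1 /
  h: zero-free functions are units among the series bounded at radius r.\<close>

lemma no_zero_inverse_bound:
  assumes h: "entire h" and r: "r > 0" and nz: "\<And>x. absv x \<le> r \<Longrightarrow> fps_value h x \<noteq> 0"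
  shows "fps_nth h 0 \<noteq> 0" "absv (fps_nth (inverse h) n) * r ^ n \<le> 1 / absv (fps_nth h 0)"
proof -
  note lt = no_zero_coeff_less[OF h r nz]
  show h0: "fps_nth h 0 \<noteq> 0"
  proof
    assume "fps_nth h 0 = 0"
    with lt[of 1] have "absv (fps_nth h 1) * r < 0" by simp
    moreover have "0 \<le> absv (fps_nth h 1) * r" using absv_nonneg r by simp
    ultimately show False by linarith
  qed
  show "absv (fps_nth (inverse h) n) * r ^ n \<le> 1 / absv (fps_nth h 0)"
  proof (induction n rule: less_induct)
    case (less n)
    show ?case
    proof (cases "n = 0")
      case True thus ?thesis by (simp add: absv_inverse flip: inverse_eq_divide)
    next
      case False
      have "0 = fps_nth (h * inverse h) n" using h0 False by (simp add: inverse_mult_eq_1')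
      also have "\<dots> = fps_nth h 0 * fps_nth (inverse h) n
          + (\<Sum>i\<in>{0..n} - {0}. fps_nth h i * fps_nth (inverse h) (n - i))"
        unfolding fps_mult_nth by (subst sum.remove[of _ 0]) auto
      finally have "fps_nth h 0 * fps_nth (inverse h) n
          = - (\<Sum>i\<in>{0..n} - {0}. fps_nth h i * fps_nth (inverse h) (n - i))"
        by (simp add: eq_neg_iff_add_eq_0)
      hence "absv (fps_nth h 0 * fps_nth (inverse h) n)
          = absv (\<Sum>i\<in>{0..n} - {0}. fps_nth h i * fps_nth (inverse h) (n - i))"
        by (simp only: absv_minus)
      also have "\<dots> \<le> 1 / r ^ n"
      proof (rule absv_sum_le)
        fix i assume i: "i \<in> {0..n} - {0}"
        have "absv (fps_nth h i * fps_nth (inverse h) (n - i)) * r ^ n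
            = (absv (fps_nth h i) * r ^ i) * (absv (fps_nth (inverse h) (n - i)) * r ^ (n - i))"
          using i by (simp add: absv_mult mult_ac flip: power_add)
        also have "\<dots> \<le> absv (fps_nth h 0) * (1 / absv (fps_nth h 0))"
          using i r lt[of i] less[of "n - i"] False
          by (intro mult_mono) (auto simp: absv_nonneg)
        also have "\<dots> = 1" using h0 by (simp add: absv_eq_0_iff)
        finally show "absv (fps_nth h i * fps_nth (inverse h) (n - i)) \<le> 1 / r ^ n"
          using r by (simp add: pos_le_divide_eq)
      qed (use r in auto)
      finally have "absv (fps_nth h 0) * (absv (fps_nth (inverse h) n) * r ^ n) \<le> 1"
        using r by (simp add: absv_mult pos_le_divide_eq mult_ac)
      thus ?thesis using h0 by (simp add: pos_le_divide_eq mult_ac)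
    qed
  qed
qed

section \<open>From local to global divisibility\<close>

abbreviation lin :: "'a \<Rightarrow> 'a fps" where
  "lin a \<equiv> fps_X - fps_const a"

lemma lin_nonzero [simp]: "lin a \<noteq> 0"
proof
  assume "lin a = 0"
  hence "fps_nth (lin a) 1 = 0" by simp
  thus False by simp
qed

lemma lin_power_dvd_cancel:
  assumes "entire x" "entire y" "entire q" "lin a ^ m * q = x * y" "fps_value y a \<noteq> 0"
  shows "\<exists>x'. entire x' \<and> x = lin a ^ m * x'"
  using assms
proof (induction m arbitrary: x)
  case (Suc m)
  have "fps_value (x * y) a = 0"
    unfolding Suc.prems(4)[symmetric] using Suc.prems(3) by (simp add: entire_intros)
  hence "fps_value x a = 0" using Suc.prems by simp
  then obtain x1 where x1: "entire x1" "x = lin a * x1" using Suc.prems by (auto simp: value_0_iff)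
  have "lin a * (lin a ^ m * q) = lin a * (x1 * y)" using Suc.prems(4) x1(2) by (simp add: mult_ac)
  hence "lin a ^ m * q = x1 * y" by simp
  from Suc.IH[OF x1(1) Suc.prems(2,3) this Suc.prems(5)] obtain x' where "entire x'" "x1 = lin a ^ m * x'"
    by blast
  thus ?case using x1(2) by (auto simp: mult_ac)
qed (auto intro: exI[of _ x])

text \<open>The comparison of orders of vanishing at all points, phrased through the powers of
  linear factors that divide D, so that no order function has to be chosen.\<close>

definition locally_dvd :: "'a fps \<Rightarrow> 'a fps \<Rightarrow> bool" where
  "locally_dvd D N \<longleftrightarrow>
     (\<forall>a m q. entire q \<longrightarrow> D = lin a ^ m * q \<longrightarrow> (\<exists>q'. entire q' \<and> N = lin a ^ m * q'))"

text \<open>Each zero of D in the disc is split off from D and N simultaneously. Local divisibility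
  persists: at the removed point both orders drop by one, elsewhere X - a does not vanish and
  cancels.\<close>

lemma zero_free_factorization:
  assumes "entire D" "r > 0" "dominant D r n" "entire N" "locally_dvd D N"
  shows "\<exists>P E M. P \<noteq> 0 \<and> entire E \<and> entire M \<and> D = fps_of_poly P * E \<and> N = fps_of_poly P * M \<and>
    (\<forall>x. absv x \<le> r \<longrightarrow> fps_value E x \<noteq> 0)"
  using assms
proof (induction n arbitrary: D N)
  case 0
  show ?case using 0 dominant_0_no_zero[of D r]
    by (intro exI[of _ 1] exI[of _ D] exI[of _ N]) auto
next
  case (Suc n)
  show ?case
  proof (cases "\<exists>a. absv a \<le> r \<and> fps_value D a = 0")
    case False
    thus ?thesis using Suc by (intro exI[of _ 1] exI[of _ D] exI[of _ N]) auto
  next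
    case True
    then obtain a where a: "absv a \<le> r" "fps_value D a = 0" by blast
    let ?D = "fps_div_linear a D"
    have D: "D = lin a * ?D" "entire ?D" 
      using div_linear_eq[of D a] entire_div_linear[of D a] a(2) Suc.prems(1) by auto
    obtain N1 where N1: "entire N1" "N = lin a * N1"
      using Suc.prems(5) D unfolding locally_dvd_def by (metis power_one_right)
    have "locally_dvd ?D N1"
      unfolding locally_dvd_def
    proof (intro allI impI)
      fix b m q assume q: "entire q" "?D = lin b ^ m * q"
      show "\<exists>q'. entire q' \<and> N1 = lin b ^ m * q'"
      proof (cases "a = b")
        case True
        have "D = lin b ^ Suc m * q" using D(1) q(2) True by (simp add: mult_ac)
        then obtain q' where q': "entire q'" "N = lin b ^ Suc m * q'"
          using Suc.prems(5) q(1) unfolding locally_dvd_def by blast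
        hence "lin b * N1 = lin b * (lin b ^ m * q')" using N1(2) True by (simp add: mult_ac)
        hence "N1 = lin b ^ m * q'" by simp
        thus ?thesis using q'(1) by blast
      next
        case False
        have "D = lin b ^ m * (lin a * q)" using D(1) q(2) by (simp add: mult_ac)
        then obtain q' where q': "entire q'" "N = lin b ^ m * q'"
          using Suc.prems(5) q(1) entire_mult[OF entire_linear q(1)] unfolding locally_dvd_def by blast
        show ?thesis
          by (rule lin_power_dvd_cancel[OF N1(1) entire_linear[of a] q'(1)])
            (use q' N1 False in \<open>auto simp: mult_ac\<close>)
      qed
    qed
    from Suc.IH[OF D(2) Suc.prems(2) dominant_div_linear(1)[OF Suc.prems(1,2) a(1) Suc.prems(3)] N1(1) this]
    obtain P E M where P: "P \<noteq> 0" "entire E" "entire M" "?D = fps_of_poly P * E" "N1 = fps_of_poly P * M"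
      "\<forall>x. absv x \<le> r \<longrightarrow> fps_value E x \<noteq> 0" by blast
    have lin: "lin a = fps_of_poly [:-a, 1:]" by (simp add: fps_of_poly_pCons)
    have "D = fps_of_poly ([:-a, 1:] * P) * E" "N = fps_of_poly ([:-a, 1:] * P) * M"
      unfolding fps_of_poly_mult lin[symmetric] using P D(1) N1(2) by (simp_all add: mult_ac)
    moreover have "[:-a, 1:] * P \<noteq> 0" using P(1) by (simp del: mult_pCons_left)
    ultimately show ?thesis using P by blast
  qed
qed

lemma locally_dvd_self [simp]: "locally_dvd D D"
  by (auto simp: locally_dvd_def)

text \<open>After removing the common polynomial factor for a disc, the quotient is M / E with E a
  unit there, so its coefficients are bounded at that radius. As a formal series the quotient does
  not depend on the radius, hence it is entire. This does the work of infinite products.\<close>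

lemma locally_dvd_imp_dvd:
  assumes D: "entire D" "D \<noteq> 0" and N: "entire N" and dvd: "locally_dvd D N"
  shows "\<exists>\<sigma>. entire \<sigma> \<and> N = \<sigma> * D"
proof -
  have *: "\<exists>\<sigma> C. N = \<sigma> * D \<and> (\<forall>n. absv (fps_nth \<sigma> n) * r ^ n \<le> C)" if r: "r > 0" for r
  proof -
    obtain n where "dominant D r n" using ex_peak[OF D r] by blast
    from zero_free_factorization[OF D(1) r this N dvd]
    obtain P E M where P: "P \<noteq> 0" "entire E" "entire M" "D = fps_of_poly P * E" "N = fps_of_poly P * M"
      and nz: "\<And>x. absv x \<le> r \<Longrightarrow> fps_value E x \<noteq> 0" by blast
    note inv = no_zero_inverse_bound[OF P(2) r nz]
    obtain C where C: "\<And>n. absv (fps_nth M n) * r ^ n \<le> C" using entire_bound[OF P(3) r] by blast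
    have "N = (M * inverse E) * D"
    proof -
      have "(M * inverse E) * D = fps_of_poly P * M * (E * inverse E)" by (simp add: P(4) mult_ac)
      also have "E * inverse E = 1" using inv(1) by (rule inverse_mult_eq_1')
      finally show ?thesis by (simp only: P(5) mult_1_right)
    qed
    moreover have "absv (fps_nth (M * inverse E) n) * r ^ n \<le> C * (1 / absv (fps_nth E 0))" for n
      by (rule mult_coeff_bound[OF C inv(2) r])
    ultimately show ?thesis by blast
  qed
  obtain \<sigma> where \<sigma>: "N = \<sigma> * D" using *[of 1] by auto
  have "entire \<sigma>" unfolding entire_iff
  proof (intro allI impI)
    fix r :: real assume "r > 0"
    then obtain \<tau> C where \<tau>: "N = \<tau> * D" "\<forall>n. absv (fps_nth \<tau> n) * r ^ n \<le> C" using * by blast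
    have "\<tau> = \<sigma>" using \<sigma> \<tau>(1) D(2) by simp
    thus "\<exists>C. \<forall>n. absv (fps_nth \<sigma> n) * r ^ n \<le> C" using \<tau>(2) by blast
  qed
  with \<sigma> show ?thesis by blast
qed

lemma fps_eq_poly:
  assumes "\<And>n. n > N \<Longrightarrow> fps_nth h n = 0" shows "\<exists>P. h = fps_of_poly (P :: 'a poly)"
proof -
  have "coeff (\<Sum>i\<le>N. monom (fps_nth h i) i) n = fps_nth h n" for n
    using assms[of n] by (auto simp: coeff_sum not_le)
  thus ?thesis by (metis fps_ext fps_of_poly_nth)
qed

text \<open>Once the finitely many zeros are split off, the cofactor E is zero-free on every disc.
  Dominance of its constant term at all radii forces every other coefficient to vanish.\<close>

lemma finite_zeros_imp_poly:
  assumes h: "entire h" "h \<noteq> 0" and fin: "finite {x :: 'a. fps_value h x = 0}"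
  shows "\<exists>P. P \<noteq> 0 \<and> h = fps_of_poly P"
proof -
  define r where "r = Max (insert 1 (absv ` {x. fps_value h x = 0}))"
  have r: "r > 0" using fin by (auto simp: r_def Max_gr_iff)
  have rz: "absv x \<le> r" if "fps_value h x = 0" for x
    using fin that by (auto simp: r_def intro!: Max_ge)
  obtain n where "dominant h r n" using ex_peak[OF h r] by blast
  from zero_free_factorization[OF h(1) r this h(1)]
  obtain P E where P: "P \<noteq> 0" "entire E" "h = fps_of_poly P * E"
    and nz: "\<And>x. absv x \<le> r \<Longrightarrow> fps_value E x \<noteq> 0" by auto
  have nz': "fps_value E x \<noteq> 0" for x
    using nz[of x] rz[of x] P by auto
  have lt: "absv (fps_nth E n) * s ^ n < absv (fps_nth E 0)" if "s > 0" "n > 0" for s n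
    using that nz' by (intro no_zero_coeff_less[OF P(2)]) auto
  have "fps_nth E n = 0" if n: "n > 0" for n
  proof (rule ccontr)
    assume E: "fps_nth E n \<noteq> 0"
    define s where "s = max 1 (absv (fps_nth E 0) / absv (fps_nth E n))"
    have s: "s \<ge> 1" "absv (fps_nth E 0) / absv (fps_nth E n) \<le> s" by (auto simp: s_def)
    have "absv (fps_nth E 0) \<le> absv (fps_nth E n) * s"
      using s(2) E by (simp add: pos_divide_le_eq mult_ac)
    also have "\<dots> \<le> absv (fps_nth E n) * s ^ n"
      using s(1) n power_increasing[of 1 n s] by (intro mult_left_mono absv_nonneg) auto
    also have "\<dots> < absv (fps_nth E 0)" using s n by (intro lt) auto
    finally show False by simp
  qed
  then obtain Q where Q: "E = fps_of_poly Q" using fps_eq_poly[of 0 E] by auto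
  have "h = fps_of_poly (P * Q)" using P(3) Q by (simp add: fps_of_poly_mult)
  moreover from this have "P * Q \<noteq> 0" using h(2) by auto
  ultimately show ?thesis by blast
qed

lemma poly_growth_imp_poly:
  assumes h: "entire h" and growth: "\<And>r. r \<ge> R \<Longrightarrow> r > 0 \<Longrightarrow> gauss_norm h r \<le> C * r ^ N"
  shows "\<exists>P. h = fps_of_poly P"
proof (rule fps_eq_poly)
  fix n assume n: "n > N"
  show "fps_nth h n = 0"
  proof (rule ccontr)
    assume hn: "fps_nth h n \<noteq> 0"
    \<comment> \<open>From this radius on, term n of h alone exceeds C r^N.\<close>
    define r where "r = max 1 (max R ((C + 1) / absv (fps_nth h n)))"
    have r: "r \<ge> 1" "r \<ge> R" "(C + 1) / absv (fps_nth h n) \<le> r" by (auto simp: r_def)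
    have "C + 1 \<le> absv (fps_nth h n) * r" using r(3) hn by (simp add: pos_divide_le_eq mult_ac)
    hence "(C + 1) * r ^ N \<le> absv (fps_nth h n) * r ^ Suc N" using r(1) mult_right_mono[of "C + 1" _ "r ^ N"]
      by (simp add: mult_ac)
    also have "\<dots> \<le> absv (fps_nth h n) * r ^ n"
      using n r(1) by (intro mult_left_mono power_increasing absv_nonneg) auto
    also have "\<dots> \<le> gauss_norm h r" using r(1) by (intro gauss_norm_ge h) auto
    also have "\<dots> \<le> C * r ^ N" using growth[of r] r by auto
    finally have "r ^ N \<le> 0" by (simp add: algebra_simps)
    moreover have "r ^ N > 0" using r(1) by simp
    ultimately show False by linarith
  qed
qed

subsection \<open>Ramification and composition\<close>

text \<open>The dominant index on a disc containing \<open>a\<close> bounds how often X - a can be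
  split off.\<close>

lemma ex_order:
  assumes "entire h" "h \<noteq> 0"
  shows "\<exists>n q. entire q \<and> h = lin a ^ n * q \<and> fps_value q a \<noteq> 0"
proof -
  define r where "r = absv a + 1"
  have r: "r > 0" "absv a \<le> r" using absv_nonneg[of a] by (auto simp: r_def)
  obtain n where "dominant h r n" using ex_peak[OF assms r(1)] by blast
  thus ?thesis using assms(1)
  proof (induction n arbitrary: h)
    case 0
    thus ?case using dominant_0_no_zero[OF 0(2) r 0(1)] by (intro exI[of _ 0] exI[of _ h]) auto
  next
    case (Suc n)
    show ?case
    proof (cases "fps_value h a = 0")
      case False
      thus ?thesis using Suc.prems by (intro exI[of _ 0] exI[of _ h]) auto
    next
      case True
      hence h: "h = lin a * fps_div_linear a h" using div_linear_eq[OF Suc.prems(2), of a] by simp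
      obtain m q where "entire q" "fps_div_linear a h = lin a ^ m * q" "fps_value q a \<noteq> 0"
        using Suc.IH[OF dominant_div_linear(1)[OF Suc.prems(2) r Suc.prems(1)] entire_div_linear[OF Suc.prems(2)]]
        by blast
      thus ?thesis using h by (intro exI[of _ "Suc m"] exI[of _ q]) (simp add: mult_ac)
    qed
  qed
qed

text \<open>Only l is assumed nonzero, so the induction runs over its order at \<open>a\<close>,
  which bounds the number of cancellations.\<close>

lemma ex_reduced:
  assumes "entire h" "entire l" "l \<noteq> 0"
  shows "\<exists>m h1 l1. entire h1 \<and> entire l1 \<and> h = lin a ^ m * h1 \<and> l = lin a ^ m * l1 \<and>
    (fps_value h1 a \<noteq> 0 \<or> fps_value l1 a \<noteq> 0)"
proof -
  obtain n q where q: "entire q" "l = lin a ^ n * q" "fps_value q a \<noteq> 0"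
    using ex_order[OF assms(2,3)] by blast
  show ?thesis using assms(1) q(2)
  proof (induction n arbitrary: h l)
    case 0
    thus ?case using q by (intro exI[of _ 0] exI[of _ h] exI[of _ q]) auto
  next
    case (Suc n)
    show ?case
    proof (cases "fps_value h a = 0")
      case False
      moreover have "entire l" using Suc.prems(2) q(1) by (simp add: entire_intros)
      ultimately show ?thesis using Suc.prems(1)
        by (intro exI[of _ 0] exI[of _ h] exI[of _ l]) simp
    next
      case True
      then obtain k where k: "entire k" "h = lin a * k" using Suc.prems(1) by (auto simp: value_0_iff)
      from Suc.IH[OF k(1) refl] obtain m h1 l1 where
        "entire h1" "entire l1" "k = lin a ^ m * h1" "lin a ^ n * q = lin a ^ m * l1"
        "fps_value h1 a \<noteq> 0 \<or> fps_value l1 a \<noteq> 0" by blast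
      thus ?thesis using k Suc.prems(2)
        by (intro exI[of _ "Suc m"] exI[of _ h1] exI[of _ l1]) (auto simp: mult_ac)
    qed
  qed
qed

text \<open>\<open>has_value\<close> asks for some representation with nonvanishing denominator.
  Cross multiplication with it shows that the denominator of a reduced representation cannot vanish
  either.\<close>

lemma reduced_has_value_iff:
  assumes "entire (h :: 'a fps)" "entire l" "l \<noteq> 0" "fps_value h a \<noteq> 0 \<or> fps_value l a \<noteq> 0"
  shows "has_value (Fract h l) a y \<longleftrightarrow> fps_value l a \<noteq> 0 \<and> y = fps_value h a / fps_value l a"
proof
  assume "has_value (Fract h l) a y"
  then obtain h' l' where *: "entire h'" "entire l'" "fps_value l' a \<noteq> 0" "Fract h l = Fract h' l'"
    "y = fps_value h' a / fps_value l' a" by (auto simp: has_value_def)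
  have "l' \<noteq> 0" using *(3) by auto
  hence "h * l' = h' * l" using *(4) assms(3) by (simp add: eq_fract)
  hence "fps_value (h * l') a = fps_value (h' * l) a" by simp
  hence eq: "fps_value h a * fps_value l' a = fps_value h' a * fps_value l a" using assms * by simp
  hence "fps_value l a \<noteq> 0" using *(3) assms(4) by auto
  thus "fps_value l a \<noteq> 0 \<and> y = fps_value h a / fps_value l a"
    using *(3) eq unfolding *(5) by (simp add: frac_eq_eq)
qed (use assms in \<open>auto simp: has_value_def\<close>)

section \<open>The Wronskian under composition\<close>

definition wronskian :: "'a fps \<Rightarrow> 'a fps \<Rightarrow> 'a fps" where
  "wronskian h l = fps_deriv h * l - h * fps_deriv l"

lemma entire_wronskian: "entire h \<Longrightarrow> entire l \<Longrightarrow> entire (wronskian h l)"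
  by (simp add: wronskian_def entire_intros)

lemma wronskian_mult: "wronskian (d * h) (d * l) = d ^ 2 * wronskian h l"
  by (simp add: wronskian_def algebra_simps power2_eq_square)

lemma wronskian_commute: "wronskian l h = - wronskian h l"
  by (simp add: wronskian_def algebra_simps)

lemma value_lipschitz:
  assumes "entire h"
  obtains C where "C > 0" "\<And>x. absv (x - a) \<le> 1 \<Longrightarrow> absv (fps_value h x - fps_value h a) \<le> C * absv (x - a)"
proof -
  let ?q = "fps_div_linear a h"
  have q: "entire ?q" by (rule entire_div_linear[OF assms])
  define r where "r = absv a + 1"
  have r: "r > 0" using absv_nonneg[of a] by (auto simp: r_def)
  define C where "C = gauss_norm ?q r + 1"
  have C: "C > 0" using gauss_norm_nonneg[OF q r] by (simp add: C_def)
  moreover have "absv (fps_value h x - fps_value h a) \<le> C * absv (x - a)" if x: "absv (x - a) \<le> 1" for x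
  proof -
    have "absv ((x - a) + a) \<le> r" using x absv_nonneg[of a] by (intro absv_add_le) (auto simp: r_def)
    hence "absv (fps_value ?q x) \<le> C" using value_le_gauss_norm[OF q r, of x] by (simp add: C_def)
    moreover have "fps_value h x = fps_value (lin a * ?q + fps_const (fps_value h a)) x"
      by (subst (1) div_linear_eq[OF assms, of a]) simp
    hence "fps_value h x - fps_value h a = (x - a) * fps_value ?q x"
      using q by (simp add: entire_mult)
    ultimately show ?thesis
      by (simp add: absv_mult mult.commute[of C] mult_left_mono absv_nonneg)
  qed
  ultimately show ?thesis using that by blast
qed

lemma absv_value_locally_const:
  assumes "entire h" "fps_value h a \<noteq> 0"
  obtains \<delta> where "\<delta> > 0" "\<And>x. absv (x - a) < \<delta> \<Longrightarrow> absv (fps_value h x) = absv (fps_value h a)"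
proof -
  obtain C where C: "C > 0" "\<And>x. absv (x - a) \<le> 1 \<Longrightarrow> absv (fps_value h x - fps_value h a) \<le> C * absv (x - a)"
    using value_lipschitz[OF assms(1)] by blast
  define \<delta> where "\<delta> = min 1 (absv (fps_value h a) / C)"
  have "\<delta> > 0" using C(1) assms(2) by (simp add: \<delta>_def)
  moreover have "absv (fps_value h x) = absv (fps_value h a)" if "absv (x - a) < \<delta>" for x
  proof -
    have "absv (fps_value h x - fps_value h a) \<le> C * absv (x - a)" using that by (intro C) (simp add: \<delta>_def)
    also have "\<dots> < absv (fps_value h a)" using that C(1) by (simp add: \<delta>_def pos_less_divide_eq mult_ac)
    finally have "absv (fps_value h a + (fps_value h x - fps_value h a)) = absv (fps_value h a)"
      by (rule absv_add_eq)
    thus ?thesis by simp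
  qed
  ultimately show ?thesis using that by blast
qed

text \<open>Only values of the composition are available, not its power series. The determinant of the
  vectors \<open>(N, D)\<close> at \<open>z\<close> and at a nearby \<open>x\<close> is a bounded multiple of that of \<open>(h, l)\<close> at \<open>w\<close> and at
  \<open>u x / v x\<close>; the latter is of second order in \<open>x - z\<close>, while the former has the linear term
  \<open>(x - z) W(N, D)(z)\<close>.\<close>
lemma wronskian_pullback_aux:
  assumes ent: "entire N" "entire D" "entire h" "entire l" "entire u" "entire v"
    and v: "fps_value v z \<noteq> 0" and w: "w = fps_value u z / fps_value v z"
    and l: "fps_value l w \<noteq> 0" and W: "fps_value (wronskian h l) w = 0"
    and \<delta>: "\<delta> > 0"
    and rel: "\<And>x. absv (x - z) < \<delta> \<Longrightarrow> 
      fps_value N x * fps_value l (fps_value u x / fps_value v x)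
      = fps_value D x * fps_value h (fps_value u x / fps_value v x)"
  shows "fps_value (wronskian N D) z = 0"
proof (rule ccontr)
  assume nz: "fps_value (wronskian N D) z \<noteq> 0"
  define k1 where "k1 = fps_const (fps_value D z) * N - fps_const (fps_value N z) * D"
  have k1: "entire k1" "fps_value k1 z = 0" using ent by (auto simp: k1_def entire_intros)
  then obtain q1 where q1: "entire q1" "k1 = lin z * q1" by (auto simp: value_0_iff)
  have "fps_value (fps_deriv k1) z = fps_value (wronskian N D) z"
    using ent by (simp add: k1_def wronskian_def entire_intros)
  hence q1z: "fps_value q1 z \<noteq> 0" using nz value_deriv_linear[OF q1(1), of z] q1(2) by simp
  define k2 where "k2 = fps_const (fps_value l w) * h - fps_const (fps_value h w) * l"
  have k2: "entire k2" "fps_value k2 w = 0" using ent by (auto simp: k2_def entire_intros)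
  then obtain q2 where q2: "entire q2" "k2 = lin w * q2" by (auto simp: value_0_iff)
  have "fps_value (fps_deriv k2) w = fps_value (wronskian h l) w"
    using ent by (simp add: k2_def wronskian_def entire_intros)
  hence "fps_value q2 w = 0" using W value_deriv_linear[OF q2(1), of w] q2(2) by simp
  obtain C2 where C2: "C2 > 0" "\<And>x. absv (x - w) \<le> 1 \<Longrightarrow> absv (fps_value q2 x - fps_value q2 w) \<le> C2 * absv (x - w)"
    using value_lipschitz[OF q2(1)] by blast
  define k where "k = u - fps_const w * v"
  have k: "entire k" "fps_value k z = 0" using ent v by (auto simp: k_def entire_intros w)
  obtain C where C: "C > 0" "\<And>x. absv (x - z) \<le> 1 \<Longrightarrow> absv (fps_value k x - fps_value k z) \<le> C * absv (x - z)"
    using value_lipschitz[OF k(1)] by blast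
  obtain CD where CD: "CD > 0" "\<And>x. absv (x - z) \<le> 1 \<Longrightarrow> absv (fps_value D x - fps_value D z) \<le> CD * absv (x - z)"
    using value_lipschitz[OF ent(2)] by blast
  obtain \<delta>1 where \<delta>1: "\<delta>1 > 0" "\<And>x. absv (x - z) < \<delta>1 \<Longrightarrow> absv (fps_value q1 x) = absv (fps_value q1 z)"
    using absv_value_locally_const[OF q1(1) q1z] by blast
  obtain \<delta>2 where \<delta>2: "\<delta>2 > 0" "\<And>x. absv (x - z) < \<delta>2 \<Longrightarrow> absv (fps_value v x) = absv (fps_value v z)"
    using absv_value_locally_const[OF ent(6) v] by blast
  obtain \<delta>3 where \<delta>3: "\<delta>3 > 0" "\<And>x. absv (x - w) < \<delta>3 \<Longrightarrow> absv (fps_value l x) = absv (fps_value l w)"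
    using absv_value_locally_const[OF ent(4) l] by blast
  \<comment> \<open>A Lipschitz constant of u / v at z: it gives |y - w| <= L |t|.\<close>
  define L where "L = C / absv (fps_value v z)"
  have L: "L > 0" using C(1) v by (simp add: L_def)
  define B where "B = max CD (absv (fps_value D z))"
  define K where "K = absv (fps_value D z) * B * (C2 * L ^ 2) / absv (fps_value l w) ^ 2"
  have B: "B > 0" using CD(1) by (simp add: B_def)
  hence K: "K \<ge> 0" using C2(1) absv_nonneg by (simp add: K_def)
  \<comment> \<open>The bounds 1, \<delta>, \<open>\<delta>1\<close>, \<open>\<delta>2\<close>
    control x, while \<open>\<delta>3 / L\<close> and 1 / L keep y close enough to w. The last entry
    makes K |t| smaller than the linear coefficient, the final contradiction; K + 1 guarantees a
    positive denominator.\<close>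
  define e where "e = Min {1, \<delta>, \<delta>1, \<delta>2, \<delta>3 / L, 1 / L, absv (fps_value q1 z) / (K + 1)}"
  have "e > 0" using \<delta> \<delta>1(1) \<delta>2(1) \<delta>3(1) L q1z K by (simp add: e_def add_nonneg_pos)
  then obtain t where t: "t \<noteq> 0" "absv t < e" using ex_absv_small by blast
  define x where "x = z + t"
  have x: "absv (x - z) = absv t" by (simp add: x_def)
  have small: "absv t < 1" "absv t < \<delta>" "absv t < \<delta>1" "absv t < \<delta>2" "absv t < \<delta>3 / L" "absv t < 1 / L"
     "absv t < absv (fps_value q1 z) / (K + 1)"
    using t(2) by (simp_all add: e_def)
  define y where "y = fps_value u x / fps_value v x"
  have vx: "absv (fps_value v x) = absv (fps_value v z)" using small by (intro \<delta>2) (simp add: x)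
  hence vx0: "fps_value v x \<noteq> 0" using v by (metis absv_eq_0_iff)
  have "y - w = fps_value k x / fps_value v x"
    using vx0 ent by (simp add: y_def k_def entire_intros diff_divide_distrib)
  hence "absv (y - w) = absv (fps_value k x) / absv (fps_value v z)" by (simp add: absv_divide vx)
  also have "\<dots> \<le> C * absv t / absv (fps_value v z)"
    using C(2)[of x] k(2) small v by (intro divide_right_mono) (auto simp: x absv_nonneg)
  finally have yw: "absv (y - w) \<le> L * absv t" by (simp add: L_def)
  have yw1: "absv (y - w) \<le> 1" "absv (y - w) < \<delta>3"
    using yw small L by (simp_all add: pos_less_divide_eq mult_ac)
  have ly: "absv (fps_value l y) = absv (fps_value l w)" by (rule \<delta>3(2)[OF yw1(2)])
  hence ly0: "fps_value l y \<noteq> 0" using l by (metis absv_eq_0_iff)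
  have Dx: "absv (fps_value D x) \<le> B"
  proof -
    have "CD * absv t \<le> CD * 1" using CD(1) small by (intro mult_left_mono) auto
    hence "absv (fps_value D x - fps_value D z) \<le> B"
      using CD(2)[of x] small by (simp add: x B_def)
    hence "absv ((fps_value D x - fps_value D z) + fps_value D z) \<le> B"
      by (intro absv_add_le) (auto simp: B_def)
    thus ?thesis by simp
  qed
  have k2y: "absv (fps_value k2 y) \<le> C2 * L ^ 2 * absv t ^ 2"
  proof -
    have "fps_value k2 y = (y - w) * fps_value q2 y" using q2 by simp
    hence "absv (fps_value k2 y) \<le> absv (y - w) * (C2 * absv (y - w))"
      using C2(2)[OF yw1(1)] \<open>fps_value q2 w = 0\<close> by (simp add: absv_mult mult_left_mono absv_nonneg)
    also have "\<dots> \<le> (L * absv t) * (C2 * (L * absv t))"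
      using yw C2(1) L absv_nonneg by (intro mult_mono mult_left_mono) auto
    finally show ?thesis by (simp add: power2_eq_square mult_ac)
  qed
  have Nz: "fps_value N z = fps_value D z * fps_value h w / fps_value l w"
    using rel[of z] \<delta> l by (simp add: w field_simps)
  have Nx: "fps_value N x = fps_value D x * fps_value h y / fps_value l y"
    using rel[of x] small ly0 by (simp add: x y_def field_simps)
  have "fps_value k1 x = fps_value D z * fps_value N x - fps_value N z * fps_value D x"
    using ent by (simp add: k1_def entire_intros)
  also have "\<dots> = fps_value D z * fps_value D x * fps_value k2 y / (fps_value l w * fps_value l y)"
    unfolding Nx Nz using l ly0 ent by (simp add: k2_def entire_intros field_simps)
  finally have "absv (fps_value k1 x) = absv (fps_value D z) * absv (fps_value D x) * absv (fps_value k2 y)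
      / absv (fps_value l w) ^ 2"
    by (simp add: absv_mult absv_divide ly power2_eq_square)
  also have "\<dots> \<le> absv (fps_value D z) * B * (C2 * L ^ 2 * absv t ^ 2) / absv (fps_value l w) ^ 2"
    using Dx k2y B C2(1) by (intro divide_right_mono mult_mono) (auto simp: absv_nonneg)
  also have "\<dots> = K * absv t ^ 2" by (simp add: K_def)
  finally have "absv t * absv (fps_value q1 z) \<le> absv t * (K * absv t)"
    using q1 \<delta>1(2)[of x] small by (simp add: x absv_mult power2_eq_square mult_ac)
  hence "absv (fps_value q1 z) \<le> K * absv t" using t(1) by simp
  moreover have "K * absv t \<le> (K + 1) * absv t" using absv_nonneg by (simp add: algebra_simps)
  moreover have "(K + 1) * absv t < absv (fps_value q1 z)"
    using small(7) K by (simp add: pos_less_divide_eq mult_ac)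
  ultimately show False by linarith
qed

text \<open>Near z and w both pairs remain free of common zeros. Agreement of values in the
  projective line, poles included, therefore becomes the cross-multiplied relation
  \<open>rel\<close>, on which the local estimate operates.\<close>

lemma wronskian_pullback:
  assumes ent: "entire N" "entire D" "entire h" "entire l" "D \<noteq> 0" "l \<noteq> 0"
    and comp: "is_composition (Fract N D) (Fract h l) g" and g: "has_value g z w"
    and ND: "fps_value N z \<noteq> 0 \<or> fps_value D z \<noteq> 0"
    and hl: "fps_value h w \<noteq> 0 \<or> fps_value l w \<noteq> 0"
    and W: "fps_value (wronskian h l) w = 0"
  shows "fps_value (wronskian N D) z = 0"
proof -
  obtain u v where uv: "entire u" "entire v" "fps_value v z \<noteq> 0" "g = Fract u v"
    "w = fps_value u z / fps_value v z" using g by (auto simp: has_value_def)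
  have nz_near: "\<exists>\<delta>>0. \<forall>x. absv (x - a) < \<delta> \<longrightarrow> fps_value A x \<noteq> 0 \<or> fps_value B x \<noteq> 0"
    if "entire A" "entire B" "fps_value A a \<noteq> 0 \<or> fps_value B a \<noteq> 0" for A B a
    using that absv_value_locally_const[of A a] absv_value_locally_const[of B a]
    by (metis absv_eq_0_iff)
  obtain \<delta>1 where \<delta>1: "\<delta>1 > 0" "\<And>x. absv (x - z) < \<delta>1 \<Longrightarrow> fps_value N x \<noteq> 0 \<or> fps_value D x \<noteq> 0"
    using nz_near[OF ent(1,2) ND] by blast
  obtain \<delta>2 where \<delta>2: "\<delta>2 > 0" "\<And>x. absv (x - w) < \<delta>2 \<Longrightarrow> fps_value h x \<noteq> 0 \<or> fps_value l x \<noteq> 0"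
    using nz_near[OF ent(3,4) hl] by blast
  obtain \<delta>3 where \<delta>3: "\<delta>3 > 0" "\<And>x. absv (x - z) < \<delta>3 \<Longrightarrow> absv (fps_value v x) = absv (fps_value v z)"
    using absv_value_locally_const[OF uv(2,3)] by blast
  define k where "k = u - fps_const w * v"
  have k: "entire k" "fps_value k z = 0" using uv by (auto simp: k_def entire_intros)
  obtain C where C: "C > 0" "\<And>x. absv (x - z) \<le> 1 \<Longrightarrow> absv (fps_value k x - fps_value k z) \<le> C * absv (x - z)"
    using value_lipschitz[OF k(1)] by blast
  define \<delta> where "\<delta> = Min {1, \<delta>1, \<delta>3, \<delta>2 * absv (fps_value v z) / C}"
  have \<delta>: "\<delta> > 0" using \<delta>1(1) \<delta>2(1) \<delta>3(1) C(1) uv(3) by (simp add: \<delta>_def)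
  have rel: "fps_value N x * fps_value l (fps_value u x / fps_value v x)
      = fps_value D x * fps_value h (fps_value u x / fps_value v x)" if x: "absv (x - z) < \<delta>" for x
  proof -
    define y where "y = fps_value u x / fps_value v x"
    have x': "absv (x - z) < 1" "absv (x - z) < \<delta>1" "absv (x - z) < \<delta>3"
      "absv (x - z) < \<delta>2 * absv (fps_value v z) / C" using x by (simp_all add: \<delta>_def)
    have vx: "absv (fps_value v x) = absv (fps_value v z)" by (rule \<delta>3(2)[OF x'(3)])
    hence vx0: "fps_value v x \<noteq> 0" using uv(3) by (metis absv_eq_0_iff)
    have "y - w = fps_value k x / fps_value v x"
      using vx0 uv by (simp add: y_def k_def entire_intros diff_divide_distrib)
    hence "absv (y - w) = absv (fps_value k x) / absv (fps_value v z)" by (simp add: absv_divide vx)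
    also have "\<dots> \<le> C * absv (x - z) / absv (fps_value v z)"
      using C(2)[of x] k(2) x' by (intro divide_right_mono) (auto simp: absv_nonneg)
    also have "\<dots> < \<delta>2" using x'(4) C(1) uv(3) by (simp add: pos_less_divide_eq pos_divide_less_eq mult_ac)
    finally have "fps_value h y \<noteq> 0 \<or> fps_value l y \<noteq> 0" by (rule \<delta>2(2))
    note f = reduced_has_value_iff[OF ent(3,4,6) this]
    note F = reduced_has_value_iff[OF ent(1,2,5) \<delta>1(2)[OF x'(2)]]
    have "has_value g x y" unfolding has_value_def y_def using uv vx0 by blast
    hence eq: "has_value (Fract N D) x c \<longleftrightarrow> has_value (Fract h l) y c" for c
      using comp by (auto simp: is_composition_def)
    show ?thesis
    proof (cases "fps_value l y = 0")
      case True
      hence "fps_value D x = 0" using eq f F by blast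
      with True show ?thesis by (simp add: y_def)
    next
      case False
      hence "fps_value D x \<noteq> 0 \<and> fps_value h y / fps_value l y = fps_value N x / fps_value D x"
        using eq f F by blast
      with False show ?thesis by (simp add: y_def[symmetric] field_simps)
    qed
  qed
  show ?thesis
  proof (cases "fps_value l w = 0")
    case False
    show ?thesis by (rule wronskian_pullback_aux[OF ent(1-4) uv(1-3,5) False W \<delta> rel])
  next
    \<comment> \<open>At a pole of f both fractions are inverted: 1 / F is the composition of 1 / f
      with g, and the Wronskians only change sign.\<close>
    case True
    hence "fps_value h w \<noteq> 0" using hl by simp
    moreover have "fps_value (wronskian l h) w = 0"
      using W ent by (simp add: wronskian_commute[of l h] entire_wronskian)
    ultimately have "fps_value (wronskian D N) z = 0"
      using wronskian_pullback_aux[OF ent(2,1,4,3) uv(1-3,5) _ _ \<delta>] rel by simp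
    thus ?thesis using ent by (simp add: wronskian_commute[of D N] entire_wronskian)
  qed
qed

section \<open>Multiple zeros, multiple poles and finite fibres\<close>

lemma lin_Fract: "Fract (lin a) 1 powi 1 = Fract (lin a) 1" "Fract (lin a) 1 powi (-1) = Fract 1 (lin a)"
  by (simp_all add: power_int_minus)

text \<open>For k = N - \<beta> D one has W(N, D) = W(k, D), with value k'(z) D(z) at z. So k
  vanishes to second order, whereas a simple zero would leave a cofactor that is nonzero at
  z.\<close>

lemma wronskian_zero_imp_not_simple_zero:
  assumes ent: "entire N" "entire D" and D: "fps_value D z \<noteq> 0"
    and W: "fps_value (wronskian N D) z = 0" and \<beta>: "\<beta> = fps_value N z / fps_value D z"
  shows "zero_at (Fract N D - const_fun \<beta>) z" "\<not> simple_zero_at (Fract N D - const_fun \<beta>) z"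
proof -
  have D0: "D \<noteq> 0" using D by auto
  define k where "k = N - fps_const \<beta> * D"
  have k: "entire k" "fps_value k z = 0" using ent D by (auto simp: k_def \<beta> entire_intros)
  have eq: "Fract N D - const_fun \<beta> = Fract k D"
    using D0 by (simp add: const_fun_def k_def)
  show "zero_at (Fract N D - const_fun \<beta>) z" unfolding zero_at_def has_value_def eq
    by (rule exI[of _ k], rule exI[of _ D]) (use ent D k in auto)
  show "\<not> simple_zero_at (Fract N D - const_fun \<beta>) z"
  proof
    assume "simple_zero_at (Fract N D - const_fun \<beta>) z"
    then obtain H L where HL: "entire H" "entire L" "fps_value H z \<noteq> 0" "fps_value L z \<noteq> 0"
      "Fract k D = Fract (lin z) 1 powi 1 * Fract H L"
      unfolding simple_zero_at_def has_order_def eq by blast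
    have L0: "L \<noteq> 0" using HL by auto
    obtain q where q: "entire q" "k = lin z * q" using k by (auto simp: value_0_iff)
    have "k * L = lin z * H * D"
      using HL(5) D0 L0 unfolding lin_Fract by (simp add: eq_fract)
    hence "lin z * (q * L) = lin z * (H * D)" using q(2) by (simp add: mult_ac)
    hence "q * L = H * D" by (metis lin_nonzero mult_cancel_left)
    hence "fps_value (q * L) z = fps_value (H * D) z" by simp
    hence qz: "fps_value q z \<noteq> 0" using q HL ent D by auto
    have "N = k + fps_const \<beta> * D" by (simp add: k_def)
    hence "wronskian N D = fps_deriv k * D - k * fps_deriv D"
      by (simp add: wronskian_def algebra_simps)
    hence "fps_value (wronskian N D) z = fps_value (fps_deriv k) z * fps_value D z"
      using k ent by (simp add: entire_intros)
    also have "fps_value (fps_deriv k) z = fps_value q z"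
      unfolding q(2) by (rule value_deriv_linear[OF q(1)])
    finally show False using W qz D by simp
  qed
qed

text \<open>At a zero of D the Wronskian is - N(z) D'(z), so D vanishes to second order.\<close>

lemma wronskian_zero_imp_not_simple_pole:
  assumes ent: "entire N" "entire D" "D \<noteq> 0" and D: "fps_value D z = 0" "fps_value N z \<noteq> 0"
    and W: "fps_value (wronskian N D) z = 0"
  shows "pole_at (Fract N D) z" "\<not> simple_pole_at (Fract N D) z"
proof -
  show "pole_at (Fract N D) z" unfolding pole_at_def using reduced_has_value_iff[OF ent] D by simp
  show "\<not> simple_pole_at (Fract N D) z"
  proof
    assume "simple_pole_at (Fract N D) z"
    then obtain H L where HL: "entire H" "entire L" "fps_value H z \<noteq> 0" "fps_value L z \<noteq> 0"
      "Fract N D = Fract (lin z) 1 powi (-1) * Fract H L"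
      unfolding simple_pole_at_def has_order_def by blast
    have L0: "L \<noteq> 0" using HL by auto
    obtain q where q: "entire q" "D = lin z * q" using D ent by (auto simp: value_0_iff)
    have "N * (lin z * L) = H * D"
      using HL(5) ent(3) L0 unfolding lin_Fract by (simp add: eq_fract)
    hence "lin z * (N * L) = lin z * (H * q)" using q(2) by (simp add: mult_ac)
    hence "N * L = H * q" by (metis lin_nonzero mult_cancel_left)
    hence "fps_value (N * L) z = fps_value (H * q) z" by simp
    hence qz: "fps_value q z \<noteq> 0" using q HL ent D by auto
    have "fps_value (wronskian N D) z = - (fps_value N z * fps_value (fps_deriv D) z)"
      using ent D by (simp add: wronskian_def entire_intros)
    also have "fps_value (fps_deriv D) z = fps_value q z"
      unfolding q(2) by (rule value_deriv_linear[OF q(1)])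
    finally show False using W qz D by simp
  qed
qed

lemma meromorphicE:
  assumes "(F :: 'a fps fract) \<in> meromorphic"
  obtains h l where "entire h" "entire l" "l \<noteq> 0" "F = Fract h l"
  using assms by (auto simp: meromorphic_def)

lemma ex_reduced_Fract:
  assumes "(F :: 'a fps fract) \<in> meromorphic"
  obtains h l where "entire h" "entire l" "l \<noteq> 0" "F = Fract h l"
    "fps_value h a \<noteq> 0 \<or> fps_value l a \<noteq> 0"
proof -
  obtain h l where hl: "entire h" "entire l" "l \<noteq> 0" "F = Fract h l" using meromorphicE[OF assms] .
  obtain m h1 l1 where 1: "entire h1" "entire l1" "h = lin a ^ m * h1" "l = lin a ^ m * l1"
    "fps_value h1 a \<noteq> 0 \<or> fps_value l1 a \<noteq> 0" using ex_reduced[OF hl(1-3)] by blast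
  have "F = Fract h1 l1" "l1 \<noteq> 0" using hl(3,4) 1(3,4) by (auto simp: eq_fract)
  thus ?thesis using 1 that by blast
qed

lemma finite_fibre:
  assumes F: "F \<in> meromorphic"
    and poles: "finite {a. pole_at F a \<and> \<not> simple_pole_at F a}"
    and zeros: "\<And>\<beta>. finite {a. zero_at (F - const_fun \<beta>) a \<and> \<not> simple_zero_at (F - const_fun \<beta>) a}"
    and comp: "is_composition F (Fract h l) g"
    and hl: "entire h" "entire l" "l \<noteq> 0" "fps_value h w \<noteq> 0 \<or> fps_value l w \<noteq> 0"
    and W: "fps_value (wronskian h l) w = 0"
  shows "finite {z. has_value g z w}"
proof (rule finite_subset)
  \<comment> \<open>If l(w) = 0, division by zero makes this 0, and every point of the fibre is a
    pole of F and belongs to \<open>?P\<close>.\<close>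
  let ?\<beta> = "fps_value h w / fps_value l w"
  let ?P = "{a. pole_at F a \<and> \<not> simple_pole_at F a}"
  let ?Z = "{a. zero_at (F - const_fun ?\<beta>) a \<and> \<not> simple_zero_at (F - const_fun ?\<beta>) a}"
  show "finite (?P \<union> ?Z)" using poles zeros[of ?\<beta>] by blast
  show "{z. has_value g z w} \<subseteq> ?P \<union> ?Z"
  proof
    fix z assume "z \<in> {z. has_value g z w}"
    hence z: "has_value g z w" by simp
    obtain N D where ND: "entire N" "entire D" "D \<noteq> 0" "F = Fract N D"
      "fps_value N z \<noteq> 0 \<or> fps_value D z \<noteq> 0" using ex_reduced_Fract[OF F] by blast
    have W': "fps_value (wronskian N D) z = 0"
      using wronskian_pullback[OF ND(1,2) hl(1,2) ND(3) hl(3) _ z ND(5) hl(4) W] comp ND(4) by simp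
    show "z \<in> ?P \<union> ?Z"
    proof (cases "fps_value D z = 0")
      case True
      thus ?thesis using wronskian_zero_imp_not_simple_pole[OF ND(1-3) True _ W'] ND by auto
    next
      case False
      have "has_value F z (fps_value N z / fps_value D z)"
        using False ND unfolding has_value_def by blast
      hence "has_value (Fract h l) w (fps_value N z / fps_value D z)"
        using comp z by (auto simp: is_composition_def)
      hence "?\<beta> = fps_value N z / fps_value D z" 
        using reduced_has_value_iff[OF hl] by simp
      thus ?thesis using wronskian_zero_imp_not_simple_zero[OF ND(1,2) False W'] ND(4) by auto
    qed
  qed
qed

subsection \<open>Rationality\<close>

lemma gauss_norm_of_nat_mult_le:
  assumes "entire h" "r > 0" shows "gauss_norm (of_nat n * h) r \<le> gauss_norm h r"
proof -
  have "gauss_norm (of_nat n :: 'a fps) r = absv (of_nat n)"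
    using gauss_norm_const[OF assms(2), of "of_nat n"] by (simp only: fps_of_nat)
  hence "gauss_norm (of_nat n * h) r = absv (of_nat n) * gauss_norm h r"
    using gauss_norm_mult[of "of_nat n" h r] assms by simp
  also have "\<dots> \<le> 1 * gauss_norm h r" 
    by (intro mult_right_mono absv_of_nat_le gauss_norm_nonneg assms)
  finally show ?thesis by simp
qed

lemma gauss_norm_mult_le_mult:
  assumes "entire h" "entire l" "r > 0" "gauss_norm h r \<le> C" "gauss_norm l r \<le> D"
  shows "gauss_norm (h * l) r \<le> C * D"
  unfolding gauss_norm_mult[OF assms(1-3)] using assms gauss_norm_nonneg[of h r] gauss_norm_nonneg[of l r]
  by (intro mult_mono) auto

text \<open>Each derivative costs a factor 1 / r, T contributes r, and integers have absolute value
  at most 1. All three terms thus lose exactly one power of r against the square of the norm of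
  \<alpha>.\<close>

lemma gauss_norm_sqrt_ode_le:
  assumes h: "entire \<alpha>" and r: "r > 0" "absv w \<le> r"
  shows "gauss_norm (sqrt_ode k (lin w) \<alpha>) r \<le> (gauss_norm \<alpha> r)\<^sup>2 / r"
proof -
  let ?G = "gauss_norm \<alpha> r" and ?a1 = "fps_deriv \<alpha>" and ?T = "lin w"
  let ?a2 = "fps_deriv ?a1"
  have a1: "gauss_norm ?a1 r \<le> ?G / r" by (rule gauss_norm_deriv_le[OF h r(1)])
  have "gauss_norm ?a2 r \<le> gauss_norm ?a1 r / r" by (intro gauss_norm_deriv_le entire_deriv h r)
  also have "\<dots> \<le> ?G / r / r" using a1 r by (intro divide_right_mono) auto
  finally have a2: "gauss_norm ?a2 r \<le> ?G / r / r" .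
  have T: "gauss_norm ?T r \<le> r" using gauss_norm_linear[OF r] by simp
  have "gauss_norm (?T * (\<alpha> * ?a2)) r \<le> r * (?G * (?G / r / r))"
    using h r(1) T a2 by (intro gauss_norm_mult_le_mult) (auto simp: entire_intros)
  moreover have "gauss_norm (of_nat 2 * (?T * (\<alpha> * ?a2))) r \<le> gauss_norm (?T * (\<alpha> * ?a2)) r"
    using h r(1) by (intro gauss_norm_of_nat_mult_le) (auto simp: entire_intros)
  ultimately have 1: "gauss_norm (of_nat 2 * (?T * (\<alpha> * ?a2))) r \<le> ?G\<^sup>2 / r"
    using r(1) by (simp add: power2_eq_square)
  have "gauss_norm (?T * (?a1 * ?a1)) r \<le> r * ((?G / r) * (?G / r))"
    using h r(1) T a1 by (intro gauss_norm_mult_le_mult) (auto simp: entire_intros)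
  hence 2: "gauss_norm (?T * (?a1 * ?a1)) r \<le> ?G\<^sup>2 / r" using r(1) by (simp add: power2_eq_square)
  have "gauss_norm (\<alpha> * ?a1) r \<le> ?G * (?G / r)"
    using h r(1) a1 by (intro gauss_norm_mult_le_mult) (auto simp: entire_intros)
  moreover have "gauss_norm (of_nat (2 * k) * (\<alpha> * ?a1)) r \<le> gauss_norm (\<alpha> * ?a1) r"
    using h r(1) by (intro gauss_norm_of_nat_mult_le) (auto simp: entire_intros)
  ultimately have 3: "gauss_norm (of_nat (2 * k) * (\<alpha> * ?a1)) r \<le> ?G\<^sup>2 / r"
    by (simp add: power2_eq_square)
  have "sqrt_ode k ?T \<alpha> = of_nat 2 * (?T * (\<alpha> * ?a2)) - ?T * (?a1 * ?a1) - of_nat (2 * k) * (\<alpha> * ?a1)"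
    by (simp add: sqrt_ode_def power2_eq_square mult_ac)
  thus ?thesis using 1 2 3 h r(1)
    by (auto intro!: gauss_norm_diff_le entire_intros)
qed

lemma vanishing_gauss_norm:
  assumes h: "entire h" and le: "\<And>r. r \<ge> R \<Longrightarrow> r > 0 \<Longrightarrow> gauss_norm h r \<le> 1 / r"
  shows "h = 0"
proof -
  have "fps_nth h n = 0" for n
  proof (rule ccontr)
    assume hn: "fps_nth h n \<noteq> 0"
    define r where "r = max 1 (max R (2 / absv (fps_nth h n)))"
    have r: "r \<ge> 1" "r \<ge> R" "2 / absv (fps_nth h n) \<le> r" by (auto simp: r_def)
    have "absv (fps_nth h n) * 1 \<le> absv (fps_nth h n) * r ^ n"
      using r(1) by (intro mult_left_mono one_le_power absv_nonneg) auto
    also have "\<dots> \<le> gauss_norm h r" using r(1) by (intro gauss_norm_ge h) auto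
    also have "\<dots> \<le> 1 / r" using r by (intro le) auto
    finally have "absv (fps_nth h n) * r \<le> 1" using r(1) by (simp add: pos_le_divide_eq)
    moreover have "2 \<le> absv (fps_nth h n) * r" using r(3) hn by (simp add: pos_divide_le_eq mult_ac)
    ultimately show False by simp
  qed
  thus ?thesis by (simp add: fps_eq_iff)
qed

lemma gauss_norm_poly_le: "\<exists>C N. \<forall>r\<ge>1. gauss_norm (fps_of_poly (P :: 'a poly)) r \<le> C * r ^ N"
proof (intro exI allI impI)
  fix r :: real assume r: "r \<ge> 1"
  show "gauss_norm (fps_of_poly P) r \<le> (\<Sum>i\<le>degree P. absv (coeff P i)) * r ^ degree P"
  proof (rule gauss_norm_le)
    fix n
    show "absv (fps_nth (fps_of_poly P) n) * r ^ n \<le> (\<Sum>i\<le>degree P. absv (coeff P i)) * r ^ degree P"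
    proof (cases "n \<le> degree P")
      case True
      thus ?thesis using r absv_nonneg
        by (auto intro!: mult_mono power_increasing member_le_sum sum_nonneg)
    next
      case False
      thus ?thesis using r absv_nonneg by (auto simp: coeff_eq_0 intro!: mult_nonneg_nonneg sum_nonneg)
    qed
  qed
qed

text \<open>Since the Gauss norm is multiplicative, polynomial growth of the square forces
  polynomial growth of \<beta>.\<close>

lemma square_poly_imp_poly:
  assumes "entire (\<beta> :: 'a fps)" "\<beta>\<^sup>2 = fps_of_poly P" shows "\<exists>Q. \<beta> = fps_of_poly Q"
proof -
  obtain C N where CN: "\<And>r. r \<ge> 1 \<Longrightarrow> gauss_norm (fps_of_poly P) r \<le> C * r ^ N"
    using gauss_norm_poly_le by blast
  show ?thesis
  proof (rule poly_growth_imp_poly[OF assms(1), of 1 "\<bar>C\<bar> + 1" N])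
    fix r :: real assume r: "r \<ge> 1" "r > 0"
    have "(gauss_norm \<beta> r)\<^sup>2 \<le> C * r ^ N"
      using CN[OF r(1)] gauss_norm_power[OF assms(1) r(2), of 2] assms(2) by simp
    also have "\<dots> \<le> (\<bar>C\<bar> + 1) * r ^ N" using r by (intro mult_right_mono) auto
    also have "\<dots> \<le> ((\<bar>C\<bar> + 1) * r ^ N) * ((\<bar>C\<bar> + 1) * r ^ N)"
      using r one_le_power[OF r(1), of N] mult_mono[of 1 "\<bar>C\<bar> + 1" 1 "r ^ N"]
      by (intro mult_le_cancel_left1[THEN iffD2]) auto
    finally have "(gauss_norm \<beta> r)\<^sup>2 \<le> ((\<bar>C\<bar> + 1) * r ^ N)\<^sup>2" by (simp add: power2_eq_square)
    thus "gauss_norm \<beta> r \<le> (\<bar>C\<bar> + 1) * r ^ N" using r by (auto intro: power2_le_imp_le)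
  qed
qed

text \<open>The triple is (l^2, h l, h^2) times V / W. With f = \<beta> / \<alpha>, the third
  relation is f' = W / l^2 = V / \<alpha>; the fourth is its analogue for 1 / f = \<beta> /
  \<gamma>, whose derivative is - V / \<gamma>.\<close>

lemma wronskian_relations:
  fixes \<alpha> \<beta> \<gamma> h l V :: "'a fps"
  assumes W: "wronskian h l \<noteq> 0" and l: "l \<noteq> 0" and \<alpha>0: "\<alpha> \<noteq> 0"
    and \<alpha>: "\<alpha> * wronskian h l = V * l\<^sup>2" and \<beta>: "\<beta> * wronskian h l = V * (h * l)"
    and \<gamma>: "\<gamma> * wronskian h l = V * h\<^sup>2"
  shows "h * \<alpha> = l * \<beta>" "\<alpha> * \<gamma> = \<beta>\<^sup>2" "\<alpha> * fps_deriv \<beta> - \<beta> * fps_deriv \<alpha> = V * \<alpha>"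
    "\<gamma> * fps_deriv \<beta> - \<beta> * fps_deriv \<gamma> = (- V) * \<gamma>"
proof -
  let ?W = "wronskian h l"
  have "(h * \<alpha>) * ?W = h * (\<alpha> * ?W)" by (simp add: mult_ac)
  also have "\<dots> = l * (\<beta> * ?W)" unfolding \<alpha> \<beta> by (simp add: power2_eq_square mult_ac)
  finally have "(h * \<alpha>) * ?W = (l * \<beta>) * ?W" by (simp only: mult.assoc)
  thus hl: "h * \<alpha> = l * \<beta>" using W by (simp only: mult_cancel_right) simp
  have "(\<alpha> * \<gamma>) * ?W\<^sup>2 = (\<alpha> * ?W) * (\<gamma> * ?W)" by (simp add: power2_eq_square mult_ac)
  also have "\<dots> = (\<beta> * ?W)\<^sup>2" unfolding \<alpha> \<beta> \<gamma> by (simp add: power2_eq_square mult_ac)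
  finally have "(\<alpha> * \<gamma>) * ?W\<^sup>2 = \<beta>\<^sup>2 * ?W\<^sup>2" by (simp add: power_mult_distrib)
  thus ag: "\<alpha> * \<gamma> = \<beta>\<^sup>2" using W by simp
  have d: "l * fps_deriv \<beta> = fps_deriv h * \<alpha> + h * fps_deriv \<alpha> - fps_deriv l * \<beta>"
    using arg_cong[OF hl, of fps_deriv] by (simp add: algebra_simps)
  have "l\<^sup>2 * (\<alpha> * fps_deriv \<beta> - \<beta> * fps_deriv \<alpha>) = \<alpha> * l * (l * fps_deriv \<beta>) - l * (l * \<beta>) * fps_deriv \<alpha>"
    by (simp add: power2_eq_square algebra_simps)
  also have "\<dots> = \<alpha> * l * (fps_deriv h * \<alpha> + h * fps_deriv \<alpha> - fps_deriv l * \<beta>) - l * (h * \<alpha>) * fps_deriv \<alpha>"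
    by (simp only: d hl)
  also have "\<dots> = \<alpha>\<^sup>2 * (l * fps_deriv h) - \<alpha> * fps_deriv l * (l * \<beta>)"
    by (simp add: power2_eq_square algebra_simps)
  also have "\<dots> = \<alpha> * (\<alpha> * ?W)"
    unfolding hl[symmetric] by (simp add: wronskian_def power2_eq_square algebra_simps)
  also have "\<dots> = l\<^sup>2 * (V * \<alpha>)" unfolding \<alpha> by (simp add: mult_ac)
  finally show rel: "\<alpha> * fps_deriv \<beta> - \<beta> * fps_deriv \<alpha> = V * \<alpha>" using l by simp
  have d2: "\<alpha> * fps_deriv \<gamma> = 2 * \<beta> * fps_deriv \<beta> - fps_deriv \<alpha> * \<gamma>"
    using arg_cong[OF ag, of fps_deriv] by (simp add: power2_eq_square algebra_simps)
  have "\<alpha> * (\<gamma> * fps_deriv \<beta> - \<beta> * fps_deriv \<gamma>) = (\<alpha> * \<gamma>) * fps_deriv \<beta> - \<beta> * (\<alpha> * fps_deriv \<gamma>)"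
    by (simp add: algebra_simps)
  also have "\<dots> = \<beta> * fps_deriv \<alpha> * \<gamma> - \<beta>\<^sup>2 * fps_deriv \<beta>"
    unfolding d2 ag by (simp add: algebra_simps power2_eq_square)
  also have "\<dots> = - \<gamma> * (\<alpha> * fps_deriv \<beta> - \<beta> * fps_deriv \<alpha>)"
    unfolding ag[symmetric] by (simp add: algebra_simps)
  also have "\<dots> = \<alpha> * ((- V) * \<gamma>)" unfolding rel by simp
  finally show "\<gamma> * fps_deriv \<beta> - \<beta> * fps_deriv \<gamma> = (- V) * \<gamma>"
    unfolding mult_left_cancel[OF \<alpha>0] .
qed

lemma value_at_0: "entire (h :: 'a fps) \<Longrightarrow> fps_value h 0 = fps_nth h 0"
  using div_linear_step[of h 0 0] by (simp add: fps_value_def)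

text \<open>The quotient has derivative 0, but as a power series it exists only if the denominator
  has a nonzero constant term; hence the reduction at 0. If the reduced l vanishes at 0, the
  inverted quotient is the constant 0, which contradicts l \<noteq> 0.\<close>

lemma wronskian_0_imp_proportional:
  assumes ent: "entire h" "entire l" "l \<noteq> 0" and W: "wronskian h l = 0"
  shows "\<exists>c. h = fps_const c * l"
proof -
  have quot: "\<exists>c. A = fps_const c * B" if "fps_nth B 0 \<noteq> 0" "wronskian A B = 0" for A B :: "'a fps"
  proof -
    define y where "y = A * inverse B"
    have B: "inverse B * B = 1" using that(1) by (rule inverse_mult_eq_1)
    have A: "A = y * B" using B by (simp add: y_def mult.assoc)
    have "wronskian A B = fps_deriv y * (B * B)"
      unfolding A wronskian_def by (simp add: algebra_simps)
    moreover have "B \<noteq> 0" using that(1) by auto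
    ultimately have "fps_deriv y = 0" using that(2) by simp
    hence "y = fps_const (fps_nth y 0)" by (simp add: fps_deriv_eq_0_iff)
    thus ?thesis using A by metis
  qed
  obtain m h1 l1 where 1: "entire h1" "entire l1" "h = lin 0 ^ m * h1" "l = lin 0 ^ m * l1"
    "fps_value h1 0 \<noteq> 0 \<or> fps_value l1 0 \<noteq> 0" using ex_reduced[OF ent] by blast
  have "wronskian h l = (lin 0 ^ m)\<^sup>2 * wronskian h1 l1" unfolding 1(3,4) by (rule wronskian_mult)
  hence W1: "wronskian h1 l1 = 0" using W by (simp only: mult_eq_0_iff power_eq_0_iff lin_nonzero) simp
  have l1: "l1 \<noteq> 0" using ent(3) 1(4) by auto
  show ?thesis
  proof (cases "fps_value l1 0 = 0")
    case False
    then obtain c where "h1 = fps_const c * l1" using quot[of l1 h1] W1 1(2) by (auto simp: value_at_0)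
    thus ?thesis using 1(3,4) by (intro exI[of _ c]) (simp add: mult_ac)
  next
    case True
    hence h10: "fps_nth h1 0 \<noteq> 0" using 1(1,5) by (simp add: value_at_0)
    moreover have "wronskian l1 h1 = 0" using W1 by (simp add: wronskian_commute[of l1])
    ultimately obtain c where c: "l1 = fps_const c * h1" using quot by blast
    have "fps_nth l1 0 = 0" using True 1(2) by (simp add: value_at_0)
    hence "c = 0" using c h10 by simp
    thus ?thesis using c l1 by simp
  qed
qed

text \<open>Since h and l may have common zeros, \<open>unram\<close> ranges over all ways of
  cancelling a common factor at \<open>a\<close>. The normalisation \<open>lw\<close> keeps \<alpha>
  prime to X - w; if w is a pole, the lemma is applied to 1 / f.\<close>

lemma unramified_imp_rational:
  assumes ent: "entire h" "entire l" "l \<noteq> 0" and lw: "fps_value l w \<noteq> 0"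
    and unram: "\<And>a m h1 l1. a \<noteq> w \<Longrightarrow> entire h1 \<Longrightarrow> entire l1 \<Longrightarrow> h = lin a ^ m * h1 \<Longrightarrow> l = lin a ^ m * l1
      \<Longrightarrow> fps_value h1 a \<noteq> 0 \<or> fps_value l1 a \<noteq> 0 \<Longrightarrow> fps_value (wronskian h1 l1) a \<noteq> 0"
  shows "\<exists>P Q. Q \<noteq> 0 \<and> h * fps_of_poly Q = l * fps_of_poly P"
proof (cases "wronskian h l = 0")
  case True
  then obtain c where "h = fps_const c * l" using wronskian_0_imp_proportional[OF ent] by blast
  thus ?thesis by (intro exI[of _ "[:c:]"] exI[of _ 1]) (simp add: fps_of_poly_const mult_ac)
next
  case False
  define W where "W = wronskian h l"
  have W: "entire W" "W \<noteq> 0" using False ent by (auto simp: W_def entire_wronskian)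
  obtain k W1 where W1: "entire W1" "W = lin w ^ k * W1" "fps_value W1 w \<noteq> 0"
    using ex_order[OF W] by blast
  define V where "V = lin w ^ k"
  have V: "entire V" by (simp add: V_def entire_intros)
  have dvd: "\<exists>\<sigma>. entire \<sigma> \<and> V * (x * y) = \<sigma> * W" if xy: "x \<in> {h, l}" "y \<in> {h, l}" for x y
  proof (rule locally_dvd_imp_dvd[OF W])
    have exy: "entire x" "entire y" using xy ent by auto
    show "entire (V * (x * y))" using exy V by (simp add: entire_intros)
    show "locally_dvd W (V * (x * y))"
      unfolding locally_dvd_def
    proof (intro allI impI)
      fix a m q assume q: "entire q" "W = lin a ^ m * q"
      show "\<exists>q'. entire q' \<and> V * (x * y) = lin a ^ m * q'"
      proof (cases "a = w")
        case True
        have "lin a ^ m * q = V * W1" using q(2) W1(2) by (simp add: V_def)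
        then obtain V' where "entire V'" "V = lin a ^ m * V'"
          using lin_power_dvd_cancel[OF V W1(1) q(1)] W1(3) True by blast
        thus ?thesis using exy by (intro exI[of _ "V' * (x * y)"]) (auto simp: mult_ac entire_intros)
      next
        case False
        \<comment> \<open>The common factor contributes exactly 2n to the order of W at
          \<open>a\<close>, as the reduced Wronskian is nonzero there, and at least 2n to the order
          of x y.\<close>
        obtain n h1 l1 where 1: "entire h1" "entire l1" "h = lin a ^ n * h1" "l = lin a ^ n * l1"
          "fps_value h1 a \<noteq> 0 \<or> fps_value l1 a \<noteq> 0" using ex_reduced[OF ent] by blast
        have nz: "fps_value (wronskian h1 l1) a \<noteq> 0" by (rule unram[OF False 1])
        have "W = (lin a ^ n)\<^sup>2 * wronskian h1 l1" unfolding W_def 1(3,4) by (rule wronskian_mult)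
        hence "lin a ^ m * q = (lin a ^ n)\<^sup>2 * wronskian h1 l1" using q(2) by simp
        then obtain t where t: "entire t" "(lin a ^ n)\<^sup>2 = lin a ^ m * t"
          using lin_power_dvd_cancel[OF _ entire_wronskian[OF 1(1,2)] q(1) _ nz] by (blast intro: entire_intros entire_linear)
        obtain x1 y1 where x1: "entire x1" "x = lin a ^ n * x1" "entire y1" "y = lin a ^ n * y1"
          using xy 1 by blast
        have "V * (x * y) = (lin a ^ n)\<^sup>2 * (V * (x1 * y1))"
          unfolding x1(2,4) by (simp add: power2_eq_square mult_ac)
        thus ?thesis using t x1 V by (intro exI[of _ "t * (V * (x1 * y1))"]) (auto simp: mult_ac entire_intros)
      qed
    qed
  qed
  obtain \<alpha> where \<alpha>: "entire \<alpha>" "\<alpha> * W = V * l\<^sup>2" using dvd[of l l] by (auto simp: power2_eq_square)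
  obtain \<beta> where \<beta>: "entire \<beta>" "\<beta> * W = V * (h * l)" using dvd[of h l] by auto
  obtain \<gamma> where \<gamma>: "entire \<gamma>" "\<gamma> * W = V * h\<^sup>2" using dvd[of h h] by (auto simp: power2_eq_square)
  have V0: "V \<noteq> 0" by (simp add: V_def)
  \<comment> \<open>At w the factor V absorbs the whole zero of W, so \<alpha> vanishes there only
    if l does.\<close>
  have "V * (\<alpha> * W1) = V * l\<^sup>2" using \<alpha>(2) W1(2) by (simp add: V_def mult_ac)
  hence "\<alpha> * W1 = l\<^sup>2" using V0 by simp
  hence "fps_value (\<alpha> * W1) w = fps_value (l\<^sup>2) w" by simp
  hence \<alpha>w: "fps_value \<alpha> w \<noteq> 0" using \<alpha> W1 ent lw by auto
  hence \<alpha>0: "\<alpha> \<noteq> 0" by auto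
  note rel = wronskian_relations[OF False ent(3) \<alpha>0 \<alpha>(2)[unfolded W_def] \<beta>(2)[unfolded W_def] \<gamma>(2)[unfolded W_def]]
  let ?T = "lin w"
  have TV: "?T * fps_deriv V = of_nat k * V"
    unfolding V_def by (rule mult_deriv_power) simp
  let ?Q = "euler_part k ?T \<alpha> * euler_part k ?T \<gamma> - (euler_part k ?T \<beta>)\<^sup>2"
  have Q: "entire ?Q" using \<alpha>(1) \<beta>(1) \<gamma>(1) by (simp add: euler_part_def entire_intros)
  have id: "sqrt_ode k ?T \<alpha> * (?T * V\<^sup>2) = \<alpha>\<^sup>2 * ?Q"
    by (rule sqrt_ode_identity[OF rel(2,3) TV \<alpha>0])
  have E: "entire (sqrt_ode k ?T \<alpha>)" using \<alpha>(1) by (simp add: sqrt_ode_def entire_intros)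
  have TV2: "?T * V\<^sup>2 = ?T ^ (2 * k + 1)" by (simp add: V_def power_mult[symmetric] mult.commute[of k])
  have "?T ^ (2 * k + 1) * sqrt_ode k ?T \<alpha> = ?Q * \<alpha>\<^sup>2"
    using id unfolding TV2 by (simp add: mult.commute)
  \<comment> \<open>\<alpha> is nonzero at w, so the power of T must divide the other factor. In the
    model case R is 4 \<lambda>.\<close>
  then obtain R where R: "entire R" "?Q = ?T ^ (2 * k + 1) * R"
    using lin_power_dvd_cancel[OF Q entire_power[OF \<alpha>(1)] E] \<alpha>w \<alpha>(1) by fastforce
  have "?T ^ (2 * k + 1) * sqrt_ode k ?T \<alpha> = ?T ^ (2 * k + 1) * (\<alpha>\<^sup>2 * R)"
    using id unfolding TV2 R(2) by (simp add: mult_ac)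
  hence ER: "sqrt_ode k ?T \<alpha> = \<alpha>\<^sup>2 * R" by (metis lin_nonzero mult_cancel_left power_not_zero)
  \<comment> \<open>The Gauss norm of \<open>\<alpha>\<^sup>2 * R\<close> is a product, so the
    estimate for \<open>sqrt_ode\<close> leaves at most 1 / r for R after cancelling the square of
    the norm of \<alpha>.\<close>
  have "R = 0"
  proof (rule vanishing_gauss_norm[OF R(1), of "absv w"])
    fix r :: real assume r: "r \<ge> absv w" "r > 0"
    let ?G = "(gauss_norm \<alpha> r)\<^sup>2"
    have "?G * gauss_norm R r = gauss_norm (\<alpha>\<^sup>2 * R) r"
      using gauss_norm_mult[OF entire_power[OF \<alpha>(1)] R(1) r(2), of 2] gauss_norm_power[OF \<alpha>(1) r(2), of 2] by simp
    also have "\<dots> \<le> ?G / r" unfolding ER[symmetric] by (rule gauss_norm_sqrt_ode_le[OF \<alpha>(1) r(2,1)])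
    finally have "?G * gauss_norm R r \<le> ?G * (1 / r)" by simp
    moreover have "?G > 0" using gauss_norm_pos[OF \<alpha>(1) \<alpha>0 r(2)] by simp
    ultimately show "gauss_norm R r \<le> 1 / r" by (simp only: mult_le_cancel_left_pos)
  qed
  hence E0: "sqrt_ode k ?T \<alpha> = 0" and Q0: "?Q = 0" using ER R(2) by simp_all
  have T: "fps_deriv ?T = 1" "?T \<noteq> 0" by simp_all
  have poly: "\<exists>P. x = fps_of_poly P" if x: "x \<noteq> 0" "sqrt_ode k ?T x = 0" for x
  proof -
    obtain M where "\<And>n. n \<ge> M \<Longrightarrow> fps_nth x n = 0" using sqrt_ode_imp_poly[OF T x] by blast
    thus ?thesis using fps_eq_poly[of M x] by simp
  qed
  obtain A where A: "\<alpha> = fps_of_poly A" using poly[OF \<alpha>0 E0] by blast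
  \<comment> \<open>The determinant \<open>?Q\<close> is symmetric in \<alpha> and \<gamma>, so its
    vanishing also gives the equation for \<gamma>; exchanging the two replaces V by - V.\<close>
  have "\<exists>C. \<gamma> = fps_of_poly C"
  proof (cases "\<gamma> = 0")
    case True
    thus ?thesis by (intro exI[of _ 0]) simp
  next
    case False
    have "\<gamma> * \<alpha> = \<beta>\<^sup>2" using rel(2) by (simp add: mult.commute)
    moreover have "?T * fps_deriv (- V) = of_nat k * (- V)" using TV by simp
    ultimately have "sqrt_ode k ?T \<gamma> * (?T * (- V)\<^sup>2)
        = \<gamma>\<^sup>2 * (euler_part k ?T \<gamma> * euler_part k ?T \<alpha> - (euler_part k ?T \<beta>)\<^sup>2)"
      using rel(4) False by (intro sqrt_ode_identity)
    also have "\<dots> = \<gamma>\<^sup>2 * ?Q" by (simp add: mult.commute)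
    finally have "sqrt_ode k ?T \<gamma> * (?T * V\<^sup>2) = 0" unfolding Q0 by simp
    hence "sqrt_ode k ?T \<gamma> = 0" using V0 T(2) by (metis mult_eq_0_iff power_not_zero)
    thus ?thesis using poly[OF False] by blast
  qed
  then obtain C where C: "\<gamma> = fps_of_poly C" by blast
  have "\<beta>\<^sup>2 = fps_of_poly (A * C)" using rel(2) by (simp add: A C fps_of_poly_mult)
  then obtain B where B: "\<beta> = fps_of_poly B" using square_poly_imp_poly[OF \<beta>(1)] by blast
  have "A \<noteq> 0" using \<alpha>0 A by auto
  moreover have "h * fps_of_poly A = l * fps_of_poly B" using rel(1) A B by simp
  ultimately show ?thesis by blast
qed

text \<open>The quotient k2 / k1 = (g - w2) / (g - w1) can have zeros and poles only on the two
  fibres. Multiplied by a polynomial P that clears its poles, it becomes an entire function with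
  finitely many zeros, hence a polynomial.\<close>

lemma two_finite_fibres_imp_rational:
  assumes g: "g \<in> meromorphic" and w: "w1 \<noteq> w2"
    and fin: "finite {z. has_value g z w1}" "finite {z :: 'a. has_value g z w2}"
  shows "rational_function g"
proof -
  obtain u v where uv: "entire u" "entire v" "v \<noteq> 0" "g = Fract u v" using meromorphicE[OF g] .
  have triv: "rational_function g" if "u = fps_const c * v" for c
  proof -
    have "Fract u v = Fract (fps_of_poly [:c:]) (fps_of_poly 1)"
      using uv(3) that by (simp add: eq_fract fps_of_poly_const)
    thus ?thesis unfolding rational_function_def uv(4) by (metis one_neq_zero)
  qed
  define k1 where "k1 = u - fps_const w1 * v"
  define k2 where "k2 = u - fps_const w2 * v"
  have k: "entire k1" "entire k2" using uv by (auto simp: k1_def k2_def entire_intros)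
  show ?thesis
  proof (cases "k1 = 0 \<or> k2 = 0")
    case True
    thus ?thesis using triv[of w1] triv[of w2] by (auto simp: k1_def k2_def)
  next
    case False
    hence k0: "k1 \<noteq> 0" "k2 \<noteq> 0" by auto
    define S where "S = {z. has_value g z w1} \<union> {z. has_value g z w2}"
    have S: "finite S" using fin by (simp add: S_def)
    \<comment> \<open>At a pole of g both reduced differences take the value u1(a) \<noteq> 0. Poles
      of g therefore cancel in k2 / k1.\<close>
    have notS: "\<exists>m \<kappa>1 \<kappa>2. entire \<kappa>1 \<and> entire \<kappa>2 \<and> k1 = lin a ^ m * \<kappa>1 \<and> k2 = lin a ^ m * \<kappa>2
       \<and> fps_value \<kappa>1 a \<noteq> 0 \<and> fps_value \<kappa>2 a \<noteq> 0" if a: "a \<notin> S" for a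
    proof -
      obtain m u1 v1 where 1: "entire u1" "entire v1" "u = lin a ^ m * u1" "v = lin a ^ m * v1"
        "fps_value u1 a \<noteq> 0 \<or> fps_value v1 a \<noteq> 0" using ex_reduced[OF uv(1-3)] by blast
      have v1: "v1 \<noteq> 0" using uv(3) 1(4) by auto
      have g1: "g = Fract u1 v1" using uv(3,4) 1(3,4) v1 by (auto simp: eq_fract)
      have nz: "fps_value u1 a \<noteq> w' * fps_value v1 a" if "w' \<in> {w1, w2}" for w'
      proof
        assume eq: "fps_value u1 a = w' * fps_value v1 a"
        hence "fps_value v1 a \<noteq> 0" using 1(5) by auto
        hence "has_value g a w'" unfolding g1 reduced_has_value_iff[OF 1(1,2) v1 1(5)] using eq by simp
        thus False using a that by (auto simp: S_def)
      qed
      show ?thesis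
        by (rule exI[of _ m], rule exI[of _ "u1 - fps_const w1 * v1"], rule exI[of _ "u1 - fps_const w2 * v1"])
          (use 1 nz[of w1] nz[of w2] in \<open>simp add: k1_def k2_def entire_intros algebra_simps\<close>)
    qed
    have "\<exists>n q. entire q \<and> k1 = lin a ^ n * q \<and> fps_value q a \<noteq> 0" for a
      by (rule ex_order[OF k(1) k0(1)])
    then obtain n q where nq: "\<And>a. entire (q a)" "\<And>a. k1 = lin a ^ n a * q a" "\<And>a. fps_value (q a) a \<noteq> 0"
      by metis
    \<comment> \<open>The exponent \<open>n a\<close> is the full order of k1 at \<open>a\<close>,
      so P clears every pole of k2 / k1.\<close>
    define P where "P = (\<Prod>a\<in>S. [:-a, 1:] ^ n a)"
    have P0: "poly P a \<noteq> 0" if "a \<notin> S" for a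
      using that S by (auto simp: P_def poly_prod)
    have "locally_dvd k1 (fps_of_poly P * k2)"
      unfolding locally_dvd_def
    proof (intro allI impI)
      fix a m x assume x: "entire x" "k1 = lin a ^ m * x"
      show "\<exists>q'. entire q' \<and> fps_of_poly P * k2 = lin a ^ m * q'"
      proof (cases "a \<in> S")
        case True
        have "P = [:-a, 1:] ^ n a * (\<Prod>a\<in>S - {a}. [:-a, 1:] ^ n a)"
          unfolding P_def using S True by (rule prod.remove)
        hence P': "fps_of_poly P = lin a ^ n a * fps_of_poly (\<Prod>a\<in>S - {a}. [:-a, 1:] ^ n a)"
          by (simp add: fps_of_poly_mult fps_of_poly_power fps_of_poly_pCons)
        have "lin a ^ m * x = lin a ^ n a * q a" using nq(2)[of a] x(2) by simp
        then obtain t where "entire t" "lin a ^ n a = lin a ^ m * t"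
          using lin_power_dvd_cancel[OF entire_power[OF entire_linear] nq(1) x(1) _ nq(3)] by blast
        thus ?thesis using k P'
          by (intro exI[of _ "t * (fps_of_poly (\<Prod>a\<in>S - {a}. [:-a, 1:] ^ n a) * k2)"])
            (auto simp: mult_ac entire_intros)
      next
        case False
        then obtain m' \<kappa>1 \<kappa>2 where \<kappa>: "entire \<kappa>1" "entire \<kappa>2" "k1 = lin a ^ m' * \<kappa>1" "k2 = lin a ^ m' * \<kappa>2"
          "fps_value \<kappa>1 a \<noteq> 0" using notS by blast
        have "lin a ^ m * x = lin a ^ m' * \<kappa>1" using \<kappa>(3) x(2) by simp
        then obtain t where "entire t" "lin a ^ m' = lin a ^ m * t"
          using lin_power_dvd_cancel[OF entire_power[OF entire_linear] \<kappa>(1) x(1) _ \<kappa>(5)] by blast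
        thus ?thesis using \<kappa> by (intro exI[of _ "t * (fps_of_poly P * \<kappa>2)"]) (auto simp: mult_ac entire_intros)
      qed
    qed
    then obtain \<sigma> where \<sigma>: "entire \<sigma>" "fps_of_poly P * k2 = \<sigma> * k1"
      using locally_dvd_imp_dvd[OF k(1) k0(1)] k(2) by (blast intro: entire_mult entire_of_poly)
    have "P \<noteq> 0" using S by (auto simp: P_def)
    hence "fps_of_poly P * k2 \<noteq> 0" using k0 by simp
    hence \<sigma>0: "\<sigma> \<noteq> 0" using \<sigma>(2) by auto
    have zS: "{x. fps_value \<sigma> x = 0} \<subseteq> S"
    proof (rule subsetI, rule ccontr)
      fix a assume a: "a \<in> {x. fps_value \<sigma> x = 0}" "a \<notin> S"
      obtain m \<kappa>1 \<kappa>2 where \<kappa>: "entire \<kappa>1" "entire \<kappa>2" "k1 = lin a ^ m * \<kappa>1" "k2 = lin a ^ m * \<kappa>2"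
        "fps_value \<kappa>1 a \<noteq> 0" "fps_value \<kappa>2 a \<noteq> 0" using notS[OF a(2)] by blast
      have "lin a ^ m * (fps_of_poly P * \<kappa>2) = lin a ^ m * (\<sigma> * \<kappa>1)"
        using \<sigma>(2) \<kappa>(3,4) by (simp add: mult_ac)
      hence "fps_of_poly P * \<kappa>2 = \<sigma> * \<kappa>1" by (metis lin_nonzero mult_cancel_left power_not_zero)
      hence "fps_value (fps_of_poly P * \<kappa>2) a = fps_value (\<sigma> * \<kappa>1) a" by simp
      thus False using a P0[OF a(2)] \<kappa> \<sigma>(1) by simp
    qed
    then obtain Q where Q: "Q \<noteq> 0" "\<sigma> = fps_of_poly Q"
      using finite_zeros_imp_poly[OF \<sigma>(1) \<sigma>0 finite_subset[OF zS S]] by blast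
    \<comment> \<open>k2 / k1 = Q / P is a Moebius transform of g; this solves it for u / v.\<close>
    have eq: "u * fps_of_poly (Q - P) = v * fps_of_poly (smult w1 Q - smult w2 P)"
      using \<sigma>(2) unfolding Q(2) k1_def k2_def
      by (simp add: fps_of_poly_diff fps_of_poly_smult algebra_simps)
    have "Q - P \<noteq> 0"
    proof
      assume "Q - P = 0"
      hence "v * fps_of_poly (smult (w1 - w2) Q) = 0" using eq by (simp add: smult_diff_left)
      thus False using uv(3) w Q(1) by simp
    qed
    moreover from this have "g = Fract (fps_of_poly (smult w1 Q - smult w2 P)) (fps_of_poly (Q - P))"
      unfolding uv(4) using eq uv(3) by (simp add: eq_fract mult.commute)
    ultimately show ?thesis unfolding rational_function_def by blast
  qed
qed

lemma composition_imp_rational: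
  assumes F: "(F :: 'a fps fract) \<in> meromorphic"
    and poles: "finite {a. pole_at F a \<and> \<not> simple_pole_at F a}"
    and zeros: "\<And>\<beta>. finite {a. zero_at (F - const_fun \<beta>) a \<and> \<not> simple_zero_at (F - const_fun \<beta>) a}"
    and f: "f \<in> meromorphic" and g: "g \<in> meromorphic" and comp: "is_composition F f g"
    and g_irr: "\<not> rational_function g"
  shows "rational_function f"
proof -
  have fib: "finite {z. has_value g z a}"
    if "entire h1" "entire l1" "l1 \<noteq> 0" "f = Fract h1 l1" "fps_value h1 a \<noteq> 0 \<or> fps_value l1 a \<noteq> 0"
      "fps_value (wronskian h1 l1) a = 0" for h1 l1 a
    using finite_fibre[OF F poles zeros _ that(1-3,5,6)] comp that(4) by simp
  \<comment> \<open>At most one fibre is finite; if none is, any point serves as w.\<close>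
  obtain w where w: "\<And>a. a \<noteq> w \<Longrightarrow> infinite {z. has_value g z a}"
    using two_finite_fibres_imp_rational[OF g] g_irr by metis
  have unram: "fps_value (wronskian h1 l1) a \<noteq> 0"
    if "a \<noteq> w" "entire h1" "entire l1" "l1 \<noteq> 0" "f = Fract h1 l1" "fps_value h1 a \<noteq> 0 \<or> fps_value l1 a \<noteq> 0"
    for a h1 l1
    using fib[OF that(2-6)] w[OF that(1)] by blast
  obtain h l where hl: "entire h" "entire l" "l \<noteq> 0" "f = Fract h l" "fps_value h w \<noteq> 0 \<or> fps_value l w \<noteq> 0"
    using ex_reduced_Fract[OF f] by blast
  have fr: "f = Fract h1 l1" "l1 \<noteq> 0" if "h = lin a ^ m * h1" "l = lin a ^ m * l1" for a m h1 l1
    using that hl(3,4) by (auto simp: eq_fract)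
  show ?thesis
  proof (cases "fps_value l w = 0")
    case False
    obtain P Q where PQ: "Q \<noteq> 0" "h * fps_of_poly Q = l * fps_of_poly P"
      using unramified_imp_rational[OF hl(1-3) False] unram fr by metis
    hence "f = Fract (fps_of_poly P) (fps_of_poly Q)" using hl(3,4) by (simp add: eq_fract mult.commute)
    thus ?thesis using PQ(1) by (auto simp: rational_function_def)
  next
    \<comment> \<open>If w is a pole of f, rationality is proved for 1 / f and then inverted;
      exchanging h and l only changes the sign of the Wronskian.\<close>
    case True
    hence hw: "fps_value h w \<noteq> 0" using hl(5) by simp
    hence h0: "h \<noteq> 0" by auto
    have unram': "fps_value (wronskian l1 h1) a \<noteq> 0"
      if "a \<noteq> w" "entire l1" "entire h1" "l = lin a ^ m * l1" "h = lin a ^ m * h1"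
        "fps_value l1 a \<noteq> 0 \<or> fps_value h1 a \<noteq> 0" for a m h1 l1
      using unram[OF that(1,3,2) fr(2,1)[OF that(5,4)]] that
      by (simp add: wronskian_commute[of l1] entire_wronskian disj_commute)
    have "\<exists>P Q. Q \<noteq> 0 \<and> l * fps_of_poly Q = h * fps_of_poly P"
      by (rule unramified_imp_rational[OF hl(2,1) h0 hw]) (rule unram'; assumption)
    then obtain P Q where PQ: "Q \<noteq> 0" "l * fps_of_poly Q = h * fps_of_poly P" by blast
    have "P \<noteq> 0" using PQ hl(3) by auto
    moreover have "f = Fract (fps_of_poly Q) (fps_of_poly P)"
      using PQ(2) \<open>P \<noteq> 0\<close> hl(3,4) by (simp add: eq_fract mult.commute)
    ultimately show ?thesis by (auto simp: rational_function_def)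
  qed
qed

end

theorem theorem2p1:
  fixes p :: nat and absv :: "'a::{field_char_0, complete_space} \<Rightarrow> real"
    and F :: "'a fps fract"
  assumes "padic_complex_field p absv"
    and "transcendental F"
    and "finite {a. pole_at F a \<and> \<not> simple_pole_at F a}"
    and "\<And>\<beta>. finite {a. zero_at (F - const_fun \<beta>) a \<and> \<not> simple_zero_at (F - const_fun \<beta>) a}"
  shows "pseudo_prime F"
proof -
  interpret padic_complex_field p absv by (rule assms(1))
  have "F \<in> meromorphic" using assms(2) by (simp add: transcendental_def)
  thus ?thesis
    unfolding pseudo_prime_def using composition_imp_rational[OF _ assms(3,4)] by blast
qed

end
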